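(* Let $K$ be a local field of characteristic $p>0$ with algebraically closed residue field and normalized valuation $v_K$. Let $L/K$ be a totally ramified $p^2$-cyclic extension. Then there exists a Witt vector $(a_0,a_1)\in W_2(L)$ such that $(a_0^p,a_1^p)-_w(a_0,a_1)=(\alpha_0,\alpha_1)\in W_2(K)$ is reduced and $L=K(a_0,a_1)$. Let $n_i=-v_K(\alpha_i)$ for $i=0,1$. The jumps in the lower ramification filtration of $L/K$ are $n_0$ and $n_0(p^2-p+1)$ if $n_1\le n_0p$, and otherwise they are $n_0$ and $p(n_1-n_0)+n_0$.
   Context: A local field is a complete discretely valued field; valuations are normalized to have value group $\mathbb{Z}$. A $p^2$-cyclic extension is a Galois extension with group $\mathbb{Z}/p^2\mathbb{Z}$. $W_2(F)$ denotes the ring of ($p$-typical) Witt vectors of length $2$ over a field $F$ of characteristic $p$, and $-_w$ is subtraction in this ring. A Witt vector $(\alpha_0,\alpha_1)\in W_2(K)$ is called reduced if $v_K(\alpha_0)$ and $v_K(\alpha_1)$ are both coprime to $p$. For a finite Galois extension $L/K$ of local fields with group $G$ and valuation ring $S$ of $L$, the lower ramification filtration is $G_i=\{\sigma\in G: v_L(\sigma x-x)\ge i+1\ \forall x\in S\}$ for integers $i\ge -1$, and $G_u=G_{\lceil u\rceil}$ for real $u\ge -1$. A number $l\ge 0$ is a lower jump if $G_l\neq G_{l+}$, where $G_{l+}=\bigcup_{\epsilon>0}G_{l+\epsilon}$. *)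

theory Defs
  imports "HOL-Algebra.Algebra" "HOL-Algebra.Algebraic_Closure_Type"
begin

text \<open>
  The large field \<open>L\<close> is the universe of a type of class \<open>field\<close>, and its subfields are sets of
  that type. The notions of HOL-Algebra are applied to the record \<^const>\<open>ring_of_type_algebra\<close>.
\<close>

section \<open>Complete discretely valued fields\<close>

text \<open>
  A normalized discrete valuation is an integer-valued function of which only the values at nonzero
  elements matter; \<open>val_ge v n x\<close> is \<open>v x \<ge> n\<close> under the convention that \<open>v 0\<close> is infinite.
\<close>

definition normalized_valuation :: "'a::field set \<Rightarrow> ('a \<Rightarrow> int) \<Rightarrow> bool" where
  "normalized_valuation F v \<longleftrightarrow>
     (\<forall>x\<in>F - {0}. \<forall>y\<in>F - {0}. v (x * y) = v x + v y) \<and>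
     (\<forall>x\<in>F - {0}. \<forall>y\<in>F - {0}. x + y \<noteq> 0 \<longrightarrow> min (v x) (v y) \<le> v (x + y)) \<and>
     v ` (F - {0}) = UNIV"

definition val_ge :: "('a::field \<Rightarrow> int) \<Rightarrow> int \<Rightarrow> 'a \<Rightarrow> bool" where
  "val_ge v n x \<longleftrightarrow> x = 0 \<or> n \<le> v x"

definition valuation_complete :: "'a::field set \<Rightarrow> ('a \<Rightarrow> int) \<Rightarrow> bool" where
  "valuation_complete F v \<longleftrightarrow>
     (\<forall>s::nat \<Rightarrow> 'a. range s \<subseteq> F \<and> (\<forall>n. \<exists>N. \<forall>i\<ge>N. \<forall>j\<ge>N. val_ge v n (s i - s j)) \<longrightarrow>
        (\<exists>x\<in>F. \<forall>n. \<exists>N. \<forall>i\<ge>N. val_ge v n (s i - x)))"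

definition local_field :: "'a::field set \<Rightarrow> ('a \<Rightarrow> int) \<Rightarrow> bool" where
  "local_field F v \<longleftrightarrow>
     subfield F ring_of_type_algebra \<and> normalized_valuation F v \<and> valuation_complete F v"

definition valuation_ring :: "'a::field set \<Rightarrow> ('a \<Rightarrow> int) \<Rightarrow> 'a set" where
  "valuation_ring F v = {x \<in> F. val_ge v 0 x}"

definition valuation_ideal :: "'a::field set \<Rightarrow> ('a \<Rightarrow> int) \<Rightarrow> 'a set" where
  "valuation_ideal F v = {x \<in> F. val_ge v 1 x}"

definition residue_field :: "'a::field set \<Rightarrow> ('a \<Rightarrow> int) \<Rightarrow> 'a set ring" where
  "residue_field F v =
     (ring_of_type_algebra \<lparr>carrier := valuation_ring F v\<rparr>) Quot (valuation_ideal F v)"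

section \<open>Galois extensions \<open>L/K\<close>, where \<open>L\<close> is the whole type\<close>

definition Gal :: "'a::field set \<Rightarrow> ('a \<Rightarrow> 'a) set" where
  "Gal K = {\<sigma> \<in> ring_iso ring_of_type_algebra ring_of_type_algebra. \<forall>x\<in>K. \<sigma> x = x}"

definition Gal_group :: "'a::field set \<Rightarrow> ('a \<Rightarrow> 'a) monoid" where
  "Gal_group K = \<lparr>carrier = Gal K, monoid.mult = (\<lambda>\<sigma> \<tau>. \<sigma> \<circ> \<tau>), one = id\<rparr>"

definition galois_extension :: "'a::field set \<Rightarrow> bool" where
  "galois_extension K \<longleftrightarrow>
     subfield K ring_of_type_algebra \<and>
     (\<forall>x. ring.algebraic ring_of_type_algebra K x) \<and>
     {x. \<forall>\<sigma>\<in>Gal K. \<sigma> x = x} = K"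

text \<open>
  The ramification index of \<open>L/K\<close> is the positive integer \<open>e\<close> for which the normalized valuation of
  \<open>L\<close> restricts to \<open>e\<close> times that of \<open>K\<close>; here it has to be the degree.
\<close>

definition totally_ramified :: "'a::field set \<Rightarrow> ('a \<Rightarrow> int) \<Rightarrow> ('a \<Rightarrow> int) \<Rightarrow> bool" where
  "totally_ramified K vK vL \<longleftrightarrow>
     (\<exists>e::nat. ring.dimension ring_of_type_algebra e K UNIV \<and>
               (\<forall>x\<in>K - {0}. vL x = int e * vK x))"

section \<open>The lower ramification filtration of \<open>L/K\<close>\<close>

definition lower_ram :: "'a::field set \<Rightarrow> ('a \<Rightarrow> int) \<Rightarrow> int \<Rightarrow> ('a \<Rightarrow> 'a) set" where
  "lower_ram K vL i = {\<sigma> \<in> Gal K. \<forall>x\<in>valuation_ring UNIV vL. val_ge vL (i + 1) (\<sigma> x - x)}"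

definition lower_ram_real :: "'a::field set \<Rightarrow> ('a \<Rightarrow> int) \<Rightarrow> real \<Rightarrow> ('a \<Rightarrow> 'a) set" where
  "lower_ram_real K vL u = lower_ram K vL \<lceil>u\<rceil>"

definition lower_jumps :: "'a::field set \<Rightarrow> ('a \<Rightarrow> int) \<Rightarrow> real set" where
  "lower_jumps K vL =
     {l. 0 \<le> l \<and> lower_ram_real K vL l \<noteq> (\<Union>\<epsilon>\<in>{0<..}. lower_ram_real K vL (l + \<epsilon>))}"

section \<open>Witt vectors of length two\<close>

text \<open>
  The second component of a sum of \<open>p\<close>-typical Witt vectors is
  \<open>a1 + b1 + (a0^p + b0^p - (a0 + b0)^p) / p\<close>, the last summand being a polynomial in \<open>a0\<close>, \<open>b0\<close>
  with integer coefficients; see \<open>witt2_carry\<close> below for the verification.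
\<close>

definition witt2_carry :: "nat \<Rightarrow> 'a::comm_ring_1 \<Rightarrow> 'a \<Rightarrow> 'a" where
  "witt2_carry p a b = - (\<Sum>i = 1..<p. of_nat ((p choose i) div p) * a ^ i * b ^ (p - i))"

definition witt2_add :: "nat \<Rightarrow> 'a::comm_ring_1 \<times> 'a \<Rightarrow> 'a \<times> 'a \<Rightarrow> 'a \<times> 'a" where
  "witt2_add p x y = (fst x + fst y, snd x + snd y + witt2_carry p (fst x) (fst y))"

definition witt2_diff :: "nat \<Rightarrow> 'a::comm_ring_1 \<times> 'a \<Rightarrow> 'a \<times> 'a \<Rightarrow> 'a \<times> 'a" where
  "witt2_diff p x y = (THE z. witt2_add p z y = x)"

lemma witt2_carry:
  fixes a b :: "'a::comm_ring_1"
  assumes "Factorial_Ring.prime p"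
  shows "of_nat p * witt2_carry p a b = a ^ p + b ^ p - (a + b) ^ p"
proof -
  have p: "p > 0" using assms by (simp add: prime_gt_0_nat)
  let ?f = "\<lambda>i. of_nat (p choose i) * a ^ i * b ^ (p - i)"
  have "(a + b) ^ p = (\<Sum>i\<le>p. ?f i)" by (rule binomial_ring)
  also have "{..p} = insert 0 (insert p {1..<p})" using p by auto
  also have "sum ?f (insert 0 (insert p {1..<p})) = b ^ p + (a ^ p + (\<Sum>i = 1..<p. ?f i))"
    using p by (subst sum.insert; simp)+
  also have "(\<Sum>i = 1..<p. ?f i)
      = of_nat p * (\<Sum>i = 1..<p. of_nat ((p choose i) div p) * a ^ i * b ^ (p - i))"
    unfolding sum_distrib_left
  proof (rule sum.cong)
    fix i assume "i \<in> {1..<p}"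
    then have "p dvd (p choose i)"
      using assms by (intro dvd_choose_prime) auto
    then have "(p choose i) = p * ((p choose i) div p)" by simp
    then have "(of_nat (p choose i) :: 'a) = of_nat p * of_nat ((p choose i) div p)"
      by (metis of_nat_mult)
    then show "?f i = of_nat p * (of_nat ((p choose i) div p) * a ^ i * b ^ (p - i))"
      by (simp add: mult.assoc)
  qed simp
  finally show ?thesis by (simp add: witt2_carry_def algebra_simps)
qed

lemma witt2_diff_eq:
  "witt2_diff p x y =
     (fst x - fst y, snd x - snd y - witt2_carry p (fst x - fst y) (fst y))"
  unfolding witt2_diff_def
proof (rule the_equality)
  show "witt2_add p
      (fst x - fst y, snd x - snd y - witt2_carry p (fst x - fst y) (fst y)) y = x"
    by (simp add: witt2_add_def)
next
  fix z assume "witt2_add p z y = x"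
  then show "z = (fst x - fst y, snd x - snd y - witt2_carry p (fst x - fst y) (fst y))"
    by (cases z) (auto simp: witt2_add_def)
qed

text \<open>
  The value of \<open>v\<close> at \<open>0\<close> is infinite, hence not an integer coprime to \<open>p\<close>; this is why both
  components of a reduced vector are nonzero.
\<close>

definition reduced_witt2 :: "nat \<Rightarrow> ('a::field \<Rightarrow> int) \<Rightarrow> 'a \<times> 'a \<Rightarrow> bool" where
  "reduced_witt2 p v \<alpha> \<longleftrightarrow>
     fst \<alpha> \<noteq> 0 \<and> snd \<alpha> \<noteq> 0 \<and> coprime (v (fst \<alpha>)) (int p) \<and> coprime (v (snd \<alpha>)) (int p)"

text \<open>\<open>(a0, a1)\<close> generates \<open>L\<close> over \<open>K\<close> and is sent to the reduced vector \<open>(\<alpha>0, \<alpha>1)\<close> over \<open>K\<close>.\<close>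

definition reduced_witt2_generator ::
    "nat \<Rightarrow> 'a::field set \<Rightarrow> ('a \<Rightarrow> int) \<Rightarrow> 'a \<times> 'a \<Rightarrow> 'a \<times> 'a \<Rightarrow> bool" where
  "reduced_witt2_generator p K vK a \<alpha> \<longleftrightarrow>
     witt2_diff p (fst a ^ p, snd a ^ p) a = \<alpha> \<and> \<alpha> \<in> K \<times> K \<and> reduced_witt2 p vK \<alpha> \<and>
     generate_field ring_of_type_algebra (K \<union> {fst a, snd a}) = UNIV"

end

theory Submission
  imports Defs
begin

text \<open>
  Let \<open>\<sigma>\<close> generate the Galois group, let \<open>C\<close> be the carry of Witt addition and let \<open>v\<close> be the
  valuation of \<open>L\<close>, which is \<open>p\<^sup>2\<close> times \<open>v\<^sub>K\<close> on \<open>K\<close>.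

  Existence of the Witt vector. In characteristic \<open>p\<close> the operator \<open>D = \<sigma> - 1\<close> satisfies \<open>D\<^sup>p
  = \<sigma>\<^sup>p - 1\<close>, so it is nilpotent, and its kernel is \<open>K\<close>. A chain \<open>z, D z, D (D z), \<dots>\<close> that
  starts at an element not fixed by \<open>\<sigma>\<^sup>p\<close> shows that every element fixed by \<open>\<sigma>\<^sup>p\<close> is in the
  image of \<open>D\<close> (\<open>additive_hilbert90\<close>). This yields \<open>a0\<close> with \<open>D a0 = 1\<close> and then \<open>a1\<close> with \<open>D a1 =
  C(a0, 1)\<close>, that is, \<open>\<sigma>\<close> adds the Witt vector \<open>(1, 0)\<close>. Since \<open>p (1, 0) = (0, 1)\<close>, the power
  \<open>\<sigma>\<^sup>p\<close> adds \<open>1\<close> to \<open>a1\<close>, and \<open>D\<^sup>i\<^sup>+\<^sup>p\<^sup>j\<close> reduces the monomial \<open>a0\<^sup>i a1\<^sup>j\<close> with \<open>i, j < p\<close> to a nonzero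
  constant: these monomials are a basis of \<open>L\<close> over \<open>K\<close>. In particular the degree and hence
  the ramification index are \<open>p\<^sup>2\<close>. That \<open>\<alpha>0\<close> and \<open>\<alpha>1\<close> lie in \<open>K\<close> follows from the
  associativity of Witt addition (\<open>witt2_carry_cocycle\<close>). It is made reduced by adding elements \<open>b\<^sup>p - b\<close> with \<open>b \<in>
  K\<close> (\<open>artin_schreier_reduce\<close>): \<open>K\<close> being complete with algebraically closed residue field,
  every integral element has this form, and a pole of order divisible by \<open>p\<close> has the
  leading term of a \<open>p\<close>-th power.

  The jumps. The filtration can be read off from a single element \<open>y\<close> with \<open>v y\<close> coprime to
  \<open>p\<close>: for \<open>i \<ge> 1\<close>, an automorphism \<open>\<tau>\<close> lies in \<open>G\<^sub>i\<close> if and only if \<open>v (\<tau> y - y) \<ge> v y + i\<close>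
  (\<open>lower_ram_test\<close>). The given \<open>a1\<close> is not such an element when \<open>n1 > p n0\<close>, because then \<open>v
  a1 = - p n1\<close>. It is corrected by an element \<open>b\<close> of \<open>K(a0)\<close> whose \<open>p\<close>-th power approximates
  \<open>\<alpha>1\<close>: the leading term of \<open>\<alpha>1\<close> can be written as \<open>c\<^sup>p \<alpha>0\<^sup>m\<close> with \<open>c \<in> K\<close>, and \<open>\<alpha>0\<^sup>m = (a0\<^sup>p - a0)\<^sup>m\<close>
  agrees with the \<open>p\<close>-th power of \<open>a0\<^sup>m\<close> up to an explicit error. The result is \<open>v (\<alpha>1 - b\<^sup>p) =
  - p\<^sup>2 n1 + p (p - 1) n0\<close> (\<open>pth_power_approximation_by_subextension\<close>). The element \<open>y = a1 -
  b\<close> satisfies \<open>y\<^sup>p - y = (\<alpha>1 - b\<^sup>p) + b + C(\<alpha>0, a0)\<close>, and \<open>v (C(\<alpha>0, a0)) = - p n0 (p\<^sup>2 - p +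
  1)\<close>. Whether the first or the last summand has the larger pole is the case distinction
  \<open>n1 > p n0\<close> or \<open>n1 \<le> p n0\<close>, and in both cases \<open>v y = - l\<close> for the claimed second jump \<open>l\<close>.
  Since \<open>\<sigma>\<^sup>p y - y = 1\<close> and \<open>v (\<sigma> y - y) = n0 - l\<close>, the subgroup generated by \<open>\<sigma>\<^sup>p\<close> leaves the
  filtration after \<open>l\<close> and the rest of the group after \<open>n0\<close>.
\<close>

section \<open>Carries of Witt vectors of length two\<close>

definition comm_ring_hom :: "('a::comm_ring_1 \<Rightarrow> 'b::comm_ring_1) \<Rightarrow> bool" where
  "comm_ring_hom f \<longleftrightarrow> f 0 = 0 \<and> f 1 = 1 \<and> (\<forall>x y. f (x + y) = f x + f y) \<and> (\<forall>x y. f (x * y) = f x * f y)"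

lemma comm_ring_homD:
  assumes "comm_ring_hom f"
  shows "f 0 = 0" "f 1 = 1" "f (x + y) = f x + f y" "f (x * y) = f x * f y"
    and "f (- x) = - f x" and "f (x - y) = f x - f y" and "f (x ^ n) = f x ^ n" and "f (of_nat n) = of_nat n"
    and "f (sum g I) = (\<Sum>i\<in>I. f (g i))"
proof -
  show 0: "f 0 = 0" and 1: "f 1 = 1" and a: "\<And>x y. f (x + y) = f x + f y" and m: "\<And>x y. f (x * y) = f x * f y"
    using assms by (auto simp: comm_ring_hom_def)
  show mi: "f (- x) = - f x" for x
    using a[of "- x" x] 0 by (simp add: eq_neg_iff_add_eq_0)
  show "f (x - y) = f x - f y"
    using a[of x "- y"] mi[of y] by simp
  show "f (x ^ n) = f x ^ n"
    by (induction n) (auto simp: 1 m)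
  show "f (of_nat n) = of_nat n"
    by (induction n) (auto simp: 0 1 a)
  show "f (sum g I) = (\<Sum>i\<in>I. f (g i))"
    by (induction I rule: infinite_finite_induct) (auto simp: 0 a)
qed

lemma comm_ring_hom_divide:
  fixes f :: "'a::field \<Rightarrow> 'b::field"
  assumes f: "comm_ring_hom f"
  shows "f (x / y) = f x / f y"
proof (cases "y = 0")
  case False
  have "f (x / y) * f y = f x" "f y * f (inverse y) = 1"
    using False comm_ring_homD(2,4)[OF f] by (metis nonzero_eq_divide_eq, metis right_inverse)
  then show ?thesis
    by (metis eq_divide_imp mult_zero_left zero_neq_one)
qed (simp add: comm_ring_homD[OF f])

lemma comm_ring_hom_funpow:
  fixes f :: "'a::comm_ring_1 \<Rightarrow> 'a"
  shows "comm_ring_hom f \<Longrightarrow> comm_ring_hom (f ^^ k)"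
  by (induction k) (auto simp: comm_ring_hom_def)

lemma comm_ring_hom_eval_map_poly:
  assumes f: "comm_ring_hom f"
  shows "comm_ring_hom (\<lambda>q. poly (map_poly f q) a)"
proof -
  note h = comm_ring_homD[OF f]
  have pC: "poly (map_poly f (pCons c q)) a = f c + a * poly (map_poly f q) a" for c q
    by (simp add: map_poly_pCons h)
  have add: "poly (map_poly f (q + r)) a = poly (map_poly f q) a + poly (map_poly f r) a" for q r
    by (induction q r rule: poly_induct2) (auto simp: pC h algebra_simps)
  have smult: "poly (map_poly f (smult c q)) a = f c * poly (map_poly f q) a" for c q
    by (induction q) (auto simp: pC h algebra_simps)
  have "poly (map_poly f (q * r)) a = poly (map_poly f q) a * poly (map_poly f r) a" for q r
    by (induction q) (auto simp: pC h add smult algebra_simps)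
  then show ?thesis
    by (auto simp: comm_ring_hom_def add pC h one_pCons)
qed

text \<open>
  Identities between Witt polynomials are derived by multiplying with \<open>p\<close>, so they are first proved in
  a ring where \<open>p\<close> can be cancelled, the polynomial ring over the integers, and then specialized.
\<close>

lemma universal_ring_three_variables:
  fixes a b c :: "'a::comm_ring_1"
  obtains f :: "int poly poly poly \<Rightarrow> 'a" and x y z
  where "comm_ring_hom f" "f x = a" "f y = b" "f z = c"
proof -
  define f1 :: "int poly \<Rightarrow> 'a" where "f1 = (\<lambda>q. poly (map_poly of_int q) a)"
  define f2 where "f2 = (\<lambda>q. poly (map_poly f1 q) b)"
  define f3 where "f3 = (\<lambda>q. poly (map_poly f2 q) c)"
  have f1: "comm_ring_hom f1"
    unfolding f1_def by (rule comm_ring_hom_eval_map_poly) (auto simp: comm_ring_hom_def)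
  have f2: "comm_ring_hom f2"
    unfolding f2_def by (rule comm_ring_hom_eval_map_poly) (rule f1)
  have f3: "comm_ring_hom f3"
    unfolding f3_def by (rule comm_ring_hom_eval_map_poly) (rule f2)
  note h = comm_ring_homD[OF f1] comm_ring_homD[OF f2] comm_ring_homD[OF f3]
  have 1: "f1 [:0,1:] = a"
    by (simp add: f1_def map_poly_pCons)
  have 2: "f2 [:0,1:] = b" "f2 [:q:] = f1 q" for q
    by (simp_all add: f2_def map_poly_pCons h)
  have 3: "f3 [:0,1:] = c" "f3 [:q:] = f2 q" for q
    by (simp_all add: f3_def map_poly_pCons h)
  show ?thesis
    by (rule that[of f3 "[:[:[:0,1:]:]:]" "[:[:0,1:]:]" "[:0,1:]"]) (use 1 2 3 f3 in simp_all)
qed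

lemma witt2_carry_hom:
  assumes "comm_ring_hom f"
  shows "f (witt2_carry p a b) = witt2_carry p (f a) (f b)"
  by (simp add: witt2_carry_def comm_ring_homD[OF assms])

text \<open>
  This is the associativity of Witt addition. After multiplication with \<open>p\<close> both sides become
  \<open>a\<^sup>p + b\<^sup>p + c\<^sup>p - (a + b + c)\<^sup>p\<close>.
\<close>

lemma witt2_carry_cocycle:
  fixes a b c :: "'a::comm_ring_1"
  assumes p: "Factorial_Ring.prime p"
  shows "witt2_carry p a b + witt2_carry p (a + b) c = witt2_carry p b c + witt2_carry p a (b + c)"
proof -
  obtain f :: "int poly poly poly \<Rightarrow> 'a" and x y z
    where f: "comm_ring_hom f" and xyz: "f x = a" "f y = b" "f z = c"
    using universal_ring_three_variables by blast
  have "of_nat p * (witt2_carry p x y + witt2_carry p (x + y) z)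
    = of_nat p * (witt2_carry p y z + witt2_carry p x (y + z))"
    by (simp add: distrib_left witt2_carry[OF p] add.assoc)
  then have "witt2_carry p x y + witt2_carry p (x + y) z = witt2_carry p y z + witt2_carry p x (y + z)"
    using p by (simp add: prime_gt_0_nat)
  then have "f (witt2_carry p x y + witt2_carry p (x + y) z) = f (witt2_carry p y z + witt2_carry p x (y + z))"
    by simp
  then show ?thesis
    by (simp add: comm_ring_homD[OF f] witt2_carry_hom[OF f] xyz)
qed

lemma power_add_second_order:
  fixes x h :: "'a::comm_ring_1"
  shows "\<exists>q. (x + h) ^ Suc m = x ^ Suc m + of_nat (Suc m) * x ^ m * h + h ^ 2 * q"
proof (induction m)
  case 0
  show ?case by (intro exI[of _ 0]) simp
next
  case (Suc m)
  then obtain q where q: "(x + h) ^ Suc m = x ^ Suc m + of_nat (Suc m) * x ^ m * h + h ^ 2 * q"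
    by blast
  have "(x + h) ^ Suc (Suc m) = (x + h) * (x ^ Suc m + of_nat (Suc m) * x ^ m * h + h ^ 2 * q)"
    by (subst power_Suc) (simp only: q)
  also have "\<dots> = x ^ Suc (Suc m) + of_nat (Suc (Suc m)) * x ^ Suc m * h
      + h ^ 2 * (of_nat (Suc m) * x ^ m + (x + h) * q)"
    by (simp add: algebra_simps power2_eq_square)
  finally show ?case by blast
qed

text \<open>
  The sum is the second component of \<open>(a, 0)\<close> plus \<open>p\<close> times \<open>(1, 0)\<close>, and \<open>p (1, 0) = (0, 1)\<close> in
  characteristic \<open>p\<close>. Over the integers, \<open>p\<close> times the sum telescopes to \<open>a\<^sup>p + p - (a + p)\<^sup>p\<close>, which
  is \<open>p\<close> modulo \<open>p\<^sup>2\<close>.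
\<close>

lemma sum_witt2_carry_translates:
  fixes a :: "'a::comm_ring_1"
  assumes p: "Factorial_Ring.prime p" and char: "of_nat p = (0 :: 'a)"
  shows "(\<Sum>j<p. witt2_carry p (a + of_nat j) 1) = 1"
proof -
  obtain f :: "int poly poly poly \<Rightarrow> 'a" and x y z
    where f: "comm_ring_hom f" and x: "f x = a"
    using universal_ring_three_variables by metis
  have p0: "p > 0" using p by (simp add: prime_gt_0_nat)
  have "of_nat p * (\<Sum>j<n. witt2_carry p (x + of_nat j) 1) = x ^ p + of_nat n - (x + of_nat n) ^ p" for n
    by (induction n) (simp_all add: distrib_left witt2_carry[OF p] add_ac)
  from this[of p] have *: "of_nat p * (\<Sum>j<p. witt2_carry p (x + of_nat j) 1) = x ^ p + of_nat p - (x + of_nat p) ^ p" .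
  obtain q where "(x + of_nat p) ^ Suc (p - 1) = x ^ Suc (p - 1) + of_nat (Suc (p - 1)) * x ^ (p - 1) * of_nat p + of_nat p ^ 2 * q"
    using power_add_second_order by blast
  then have "(x + of_nat p) ^ p = x ^ p + of_nat p * x ^ (p - 1) * of_nat p + of_nat p ^ 2 * q"
    using p0 by simp
  then have "of_nat p * (\<Sum>j<p. witt2_carry p (x + of_nat j) 1) = of_nat p * (1 - of_nat p * (x ^ (p - 1) + q))"
    unfolding * by (simp add: algebra_simps power2_eq_square)
  then have "(\<Sum>j<p. witt2_carry p (x + of_nat j) 1) = 1 - of_nat p * (x ^ (p - 1) + q)"
    using p0 by (subst (asm) mult_left_cancel) auto
  then have "f (\<Sum>j<p. witt2_carry p (x + of_nat j) 1) = f (1 - of_nat p * (x ^ (p - 1) + q))"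
    by simp
  then show ?thesis
    by (simp add: comm_ring_homD[OF f] witt2_carry_hom[OF f] x char)
qed

lemma of_nat_power_char:
  assumes p: "Factorial_Ring.prime p" and char: "CHAR('a) = p"
  shows "(of_nat n :: 'a::comm_ring_1) ^ p = of_nat n"
proof -
  have pr: "Factorial_Ring.prime CHAR('a)" using assms by simp
  show ?thesis
    by (induction n) (use p in \<open>auto simp: freshmans_dream[OF pr char[symmetric]] prime_gt_0_nat zero_power\<close>)
qed

lemma witt2_carry_power_char:
  fixes a b :: "'a::comm_ring_1"
  assumes p: "Factorial_Ring.prime p" and char: "CHAR('a) = p"
  shows "witt2_carry p a b ^ p = witt2_carry p (a ^ p) (b ^ p)"
proof -
  have pr: "Factorial_Ring.prime CHAR('a)" using assms by simp
  note nat = of_nat_power_char[OF p char]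
  have uminus: "(- x) ^ p = - (x ^ p)" for x :: 'a
  proof -
    have "(- x + x) ^ p = (- x) ^ p + x ^ p"
      by (rule freshmans_dream[OF pr]) (simp add: char)
    then show ?thesis
      using p by (simp add: prime_gt_0_nat zero_power eq_neg_iff_add_eq_0)
  qed
  show ?thesis
    unfolding witt2_carry_def uminus
    by (subst freshmans_dream_sum[OF pr]) (simp_all add: char power_mult_distrib nat flip: power_mult, simp add: mult.commute)
qed

section \<open>Discrete valuations\<close>

text \<open>
  The value of \<open>v\<close> at \<open>0\<close> carries no information, so an equation \<open>v x = n\<close> is always used together with
  \<open>x \<noteq> 0\<close>.
\<close>

definition has_val :: "('a::field \<Rightarrow> int) \<Rightarrow> int \<Rightarrow> 'a \<Rightarrow> bool" where
  "has_val v n x \<longleftrightarrow> x \<noteq> 0 \<and> v x = n"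

lemma has_val_unique: "has_val v n x \<Longrightarrow> has_val v m x \<Longrightarrow> n = m"
  by (simp add: has_val_def)

lemma val_ge_0 [simp]: "val_ge v n 0"
  by (simp add: val_ge_def)

lemma val_ge_mono: "val_ge v n x \<Longrightarrow> m \<le> n \<Longrightarrow> val_ge v m x"
  by (auto simp: val_ge_def)

lemma has_val_imp_val_ge: "has_val v n x \<Longrightarrow> m \<le> n \<Longrightarrow> val_ge v m x"
  by (auto simp: val_ge_def has_val_def)

lemma has_val_or_val_ge_Suc: "val_ge v n x \<Longrightarrow> has_val v n x \<or> val_ge v (n + 1) x"
  by (auto simp: val_ge_def has_val_def)

lemma val_ge_iff_le: "has_val v n x \<Longrightarrow> val_ge v m x \<longleftrightarrow> m \<le> n"
  by (auto simp: val_ge_def has_val_def)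

locale discrete_valuation =
  fixes v :: "'a::field \<Rightarrow> int"
  assumes normalized: "normalized_valuation UNIV v"
begin

lemma has_val_mult: "has_val v m x \<Longrightarrow> has_val v n y \<Longrightarrow> has_val v (m + n) (x * y)"
  using normalized by (simp add: normalized_valuation_def has_val_def)

lemma has_val_1 [simp]: "has_val v 0 1"
  using has_val_mult[of "v 1" 1 "v 1" 1] by (auto simp: has_val_def)

lemma has_val_power: "has_val v m x \<Longrightarrow> has_val v (int k * m) (x ^ k)"
proof (induction k)
  case (Suc k)
  then show ?case
    using has_val_mult[of m x "int k * m" "x ^ k"] by (simp add: distrib_right)
qed simp

lemma has_val_inverse: "has_val v m x \<Longrightarrow> has_val v (- m) (inverse x)"
  using has_val_mult[of m x "v (inverse x)" "inverse x"] has_val_unique[OF has_val_1]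
  by (auto simp: has_val_def)

lemma has_val_divide: "has_val v m x \<Longrightarrow> has_val v n y \<Longrightarrow> has_val v (m - n) (x / y)"
  using has_val_mult[of m x "- n" "inverse y"] has_val_inverse[of n y] by (simp add: divide_inverse)

lemma has_val_power_int: "has_val v m x \<Longrightarrow> has_val v (k * m) (x powi k)"
  using has_val_power[of m x "nat k"] has_val_inverse[OF has_val_power[of m x "nat (- k)"]]
  by (cases "k \<ge> 0") (auto simp: power_int_def power_inverse)

lemma has_val_minus_one: "has_val v 0 (- 1)"
  using has_val_mult[of "v (- 1)" "- 1" "v (- 1)" "- 1"] has_val_unique[OF has_val_1]
  by (auto simp: has_val_def)

lemma has_val_minus: "has_val v m x \<Longrightarrow> has_val v m (- x)"
  using has_val_mult[OF has_val_minus_one, of m x] by simp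

lemma val_ge_mult: "val_ge v m x \<Longrightarrow> val_ge v n y \<Longrightarrow> val_ge v (m + n) (x * y)"
  using has_val_mult[of "v x" x "v y" y] by (auto simp: val_ge_def has_val_def)

lemma val_ge_mult_int: "val_ge v 0 x \<Longrightarrow> val_ge v n y \<Longrightarrow> val_ge v n (x * y)"
  using val_ge_mult[of 0 x n y] by simp

lemma val_ge_1 [simp]: "val_ge v 0 1"
  by (rule has_val_imp_val_ge[OF has_val_1]) simp

lemma val_ge_power: "val_ge v m x \<Longrightarrow> val_ge v (int k * m) (x ^ k)"
proof (induction k)
  case (Suc k)
  have "int (Suc k) * m = m + int k * m"
    by (simp add: algebra_simps)
  then show ?case
    using val_ge_mult[of m x "int k * m" "x ^ k"] Suc by simp
qed simp

lemma val_ge_minus: "val_ge v m x \<Longrightarrow> val_ge v m (- x)"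
  using val_ge_mult_int[OF has_val_imp_val_ge[OF has_val_minus_one order_refl], of m x] by simp

lemma val_ge_add:
  assumes "val_ge v m x" "val_ge v m y"
  shows "val_ge v m (x + y)"
proof (cases "x = 0 \<or> y = 0 \<or> x + y = 0")
  case False
  then have "min (v x) (v y) \<le> v (x + y)"
    using normalized unfolding normalized_valuation_def by blast
  then show ?thesis
    using assms False by (auto simp: val_ge_def)
qed (use assms in auto)

lemma val_ge_diff: "val_ge v m x \<Longrightarrow> val_ge v m y \<Longrightarrow> val_ge v m (x - y)"
  using val_ge_add[of m x "- y"] val_ge_minus[of m y] by simp

lemma val_ge_sum: "(\<And>i. i \<in> I \<Longrightarrow> val_ge v m (f i)) \<Longrightarrow> val_ge v m (sum f I)"
  by (induction I rule: infinite_finite_induct) (auto intro: val_ge_add)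

lemma val_ge_of_nat [simp]: "val_ge v 0 (of_nat k)"
  by (induction k) (auto intro: val_ge_add)

text \<open>
  The dominance principle behind all valuation computations below: the summand of strictly smaller
  valuation determines the valuation of a sum.
\<close>

lemma has_val_add: "has_val v m x \<Longrightarrow> val_ge v (m + 1) y \<Longrightarrow> has_val v m (x + y)"
proof -
  assume x: "has_val v m x" and y: "val_ge v (m + 1) y"
  have "val_ge v m (x + y)"
    using has_val_imp_val_ge[OF x order_refl] val_ge_mono[OF y, of m] by (simp add: val_ge_add)
  moreover have "\<not> val_ge v (m + 1) (x + y)"
    using val_ge_diff[of "m + 1" "x + y" y] x y by (auto simp: val_ge_iff_le)
  ultimately show ?thesis
    using has_val_or_val_ge_Suc by blast
qed

lemma has_val_add': "val_ge v (m + 1) y \<Longrightarrow> has_val v m x \<Longrightarrow> has_val v m (y + x)"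
  using has_val_add by (simp add: add.commute)

lemma has_val_diff: "has_val v m x \<Longrightarrow> val_ge v (m + 1) y \<Longrightarrow> has_val v m (x - y)"
  using has_val_add[of m x "- y"] val_ge_minus[of "m + 1" y] by simp

lemma has_val_diff': "val_ge v (m + 1) y \<Longrightarrow> has_val v m x \<Longrightarrow> has_val v m (y - x)"
  using has_val_minus[OF has_val_diff[of m x y]] by simp

lemma has_val_self_power:
  assumes "x ^ k = x" "x \<noteq> 0" "k > 1"
  shows "has_val v 0 x"
proof -
  have "int k * v x = v x"
    using has_val_power[of "v x" x k] assms by (auto simp: has_val_def)
  then show ?thesis
    using assms by (auto simp: has_val_def)
qed

lemma exists_has_val: "\<exists>x. has_val v m x"
proof -
  have "m \<in> v ` (UNIV - {0})"
    using normalized by (simp add: normalized_valuation_def)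
  then show ?thesis by (auto simp: has_val_def)
qed

text \<open>
  A root \<open>x\<close> of an equation whose right-hand side has a pole has a pole itself, and then \<open>x ^ k\<close>
  dominates \<open>x\<close>.
\<close>

lemma has_val_artin_schreier_root:
  assumes "has_val v m (x ^ k - x)" "m < 0" "k > 1"
  shows "has_val v (v x) x" "int k * v x = m"
proof -
  have x0: "x \<noteq> 0"
    using assms by (auto simp: has_val_def)
  then show x: "has_val v (v x) x"
    by (simp add: has_val_def)
  have neg: "v x < 0"
  proof (rule ccontr)
    assume "\<not> v x < 0"
    then have "val_ge v 0 x"
      by (auto simp: val_ge_def)
    then have "val_ge v 0 (x ^ k - x)"
      using val_ge_power[of 0 x k] by (auto intro: val_ge_diff)
    then show False
      using assms by (simp add: val_ge_iff_le)
  qed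
  have "(int k - 1) * v x < 0"
    using neg assms(3) by (intro mult_pos_neg) auto
  then have "int k * v x + 1 \<le> v x"
    by (simp add: algebra_simps)
  then have "has_val v (int k * v x) (x ^ k - x)"
    by (intro has_val_diff has_val_power x has_val_imp_val_ge[OF x])
  then show "int k * v x = m"
    using assms(1) has_val_unique by blast
qed

lemma one_add_power_second_order:
  assumes z: "val_ge v m z" "m \<ge> 0"
  shows "val_ge v (2 * m) ((1 + z) ^ k - 1 - of_nat k * z)"
proof (induction k)
  case (Suc k)
  have "(1 + z) ^ Suc k - 1 - of_nat (Suc k) * z
      = (1 + z) * ((1 + z) ^ k - 1 - of_nat k * z) + of_nat k * (z * z)"
    by (simp add: algebra_simps)
  moreover have "val_ge v (2 * m) ((1 + z) * ((1 + z) ^ k - 1 - of_nat k * z))"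
    using Suc val_ge_mono[OF z] by (intro val_ge_mult_int val_ge_add) simp_all
  moreover have "val_ge v (2 * m) (of_nat k * (z * z))"
    using val_ge_mult_int[OF val_ge_of_nat val_ge_mult[OF z(1) z(1)]] by (simp only: mult_2)
  ultimately show ?case
    by (simp add: val_ge_add)
qed simp

text \<open>
  The difference is \<open>k x\<^sup>k\<^sup>-\<^sup>1 d\<close> up to terms of higher order. The hypothesis on \<open>k\<close> says that the
  residue characteristic does not divide it.
\<close>

lemma has_val_power_add_diff:
  assumes x: "has_val v m x" and d: "has_val v n d" and "m < n" and k: "has_val v 0 (of_nat k)"
  shows "has_val v ((int k - 1) * m + n) ((x + d) ^ k - x ^ k)"
proof -
  define z where "z = d / x"
  have x0: "x \<noteq> 0" using x by (simp add: has_val_def)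
  have z: "has_val v (n - m) z"
    unfolding z_def by (rule has_val_divide[OF d x])
  have kz: "has_val v (n - m) (of_nat k * z)"
    using has_val_mult[OF k z] by simp
  have "val_ge v (n - m + 1) ((1 + z) ^ k - 1 - of_nat k * z)"
    using one_add_power_second_order[of "n - m" z k] has_val_imp_val_ge[OF z order_refl] assms(3)
    using val_ge_mono[of v "2 * (n - m)" _ "n - m + 1"] by simp
  from has_val_add[OF kz this] have "has_val v (n - m) ((1 + z) ^ k - 1)"
    by simp
  from has_val_mult[OF has_val_power[OF x, of k] this]
  have "has_val v (int k * m + (n - m)) (x ^ k * ((1 + z) ^ k - 1))" .
  also have "x ^ k * ((1 + z) ^ k - 1) = (x + d) ^ k - x ^ k"
    using x0 by (simp add: z_def right_diff_distrib flip: power_mult_distrib) (simp add: algebra_simps)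
  finally show ?thesis
    by (simp add: algebra_simps)
qed

text \<open>
  Among the terms \<open>x\<^sup>i y\<^sup>p\<^sup>-\<^sup>i\<close> with \<open>0 < i < p\<close> the one with \<open>i = p - 1\<close> dominates, and its coefficient
  is \<open>1\<close>.
\<close>

lemma has_val_witt2_carry:
  assumes p: "Factorial_Ring.prime p" and x: "has_val v m x" and y: "has_val v n y" and "m < n"
  shows "has_val v ((int p - 1) * m + n) (witt2_carry p x y)"
proof -
  have p2: "p \<ge> 2" using p by (rule prime_ge_2_nat)
  let ?f = "\<lambda>i. of_nat ((p choose i) div p) * x ^ i * y ^ (p - i)"
  have "p choose (p - 1) = p"
    using p2 binomial_symmetric[of 1 p] by simp
  then have top: "?f (p - 1) = x ^ (p - 1) * y"
    using p2 by simp
  have "{1..<p} = insert (p - 1) {1..<p - 1}"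
    using p2 by auto
  then have C: "witt2_carry p x y = - (?f (p - 1) + sum ?f {1..<p - 1})"
    unfolding witt2_carry_def by simp
  have "val_ge v ((int p - 1) * m + n + 1) (?f i)" if "i \<in> {1..<p - 1}" for i
  proof -
    have val: "has_val v (int i * m + int (p - i) * n) (x ^ i * y ^ (p - i))"
      using x y by (intro has_val_mult has_val_power)
    have "(int p - 1 - int i) * (n - m) \<ge> 1 * 1"
      using that assms(4) by (intro mult_mono) auto
    moreover have "int (p - i) = int p - int i"
      using that by (intro of_nat_diff) auto
    ultimately have "(int p - 1) * m + n + 1 \<le> int i * m + int (p - i) * n"
      by (simp add: algebra_simps)
    then show ?thesis
      unfolding mult.assoc by (intro val_ge_mult_int val_ge_of_nat has_val_imp_val_ge[OF val])
  qed
  then have "val_ge v ((int p - 1) * m + n + 1) (sum ?f {1..<p - 1})"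
    by (rule val_ge_sum)
  moreover have "has_val v ((int p - 1) * m + n) (?f (p - 1))"
    unfolding top using has_val_mult[OF has_val_power[OF x, of "p - 1"] y] p2 by (simp add: of_nat_diff)
  ultimately show ?thesis
    unfolding C by (intro has_val_minus has_val_add)
qed

end

section \<open>Bases, cyclic Galois groups and residue fields in elementary terms\<close>

lemma rta_simps [simp]:
  "carrier ring_of_type_algebra = UNIV" "x \<otimes>\<^bsub>ring_of_type_algebra\<^esub> y = x * y"
  "x \<oplus>\<^bsub>ring_of_type_algebra\<^esub> y = x + y" "\<one>\<^bsub>ring_of_type_algebra\<^esub> = 1" "\<zero>\<^bsub>ring_of_type_algebra\<^esub> = 0"
  by (simp_all add: ring_of_type_algebra_def)

lemma rta_a_inv [simp]:
  fixes x :: "'a::field"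
  shows "\<ominus>\<^bsub>ring_of_type_algebra\<^esub> x = - x"
proof -
  interpret field "ring_of_type_algebra :: 'a ring" by (rule field_from_type_algebra)
  show ?thesis by (rule minus_equality) auto
qed

lemma rta_m_inv [simp]:
  fixes x :: "'a::field"
  shows "x \<noteq> 0 \<Longrightarrow> inv\<^bsub>ring_of_type_algebra\<^esub> x = inverse x"
proof -
  interpret field "ring_of_type_algebra :: 'a ring" by (rule field_from_type_algebra)
  show "x \<noteq> 0 \<Longrightarrow> inv\<^bsub>ring_of_type_algebra\<^esub> x = inverse x"
    by (rule comm_inv_char) auto
qed

lemma subfield_rta_closed:
  fixes K :: "'a::field set"
  assumes "subfield K ring_of_type_algebra"
  shows "0 \<in> K" "1 \<in> K" "x \<in> K \<Longrightarrow> y \<in> K \<Longrightarrow> x + y \<in> K" "x \<in> K \<Longrightarrow> y \<in> K \<Longrightarrow> x * y \<in> K"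
    "x \<in> K \<Longrightarrow> - x \<in> K" "x \<in> K \<Longrightarrow> inverse x \<in> K"
proof -
  interpret field "ring_of_type_algebra :: 'a ring" by (rule field_from_type_algebra)
  note s = subfieldE(1)[OF assms]
  show 0: "0 \<in> K" and "1 \<in> K" "x \<in> K \<Longrightarrow> y \<in> K \<Longrightarrow> x + y \<in> K" "x \<in> K \<Longrightarrow> y \<in> K \<Longrightarrow> x * y \<in> K"
    "x \<in> K \<Longrightarrow> - x \<in> K"
    using subringE(2,3,5,6,7)[OF s] by auto
  show "x \<in> K \<Longrightarrow> inverse x \<in> K"
    using subfield_m_inv(1)[OF assms, of x] 0 by (cases "x = 0") auto
qed

lemma combine_rta:
  "ring.combine (ring_of_type_algebra :: 'a::field ring) ks us = (\<Sum>i<min (length ks) (length us). ks ! i * us ! i)"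
proof -
  interpret field "ring_of_type_algebra :: 'a ring" by (rule field_from_type_algebra)
  show ?thesis
    by (induction ks us rule: combine.induct) (auto simp: sum.lessThan_Suc_shift simp del: sum.lessThan_Suc)
qed

definition linearly_independent_over :: "'a::field set \<Rightarrow> nat \<Rightarrow> (nat \<Rightarrow> 'a) \<Rightarrow> bool" where
  "linearly_independent_over K n f \<longleftrightarrow>
     (\<forall>c. (\<forall>k<n. c k \<in> K) \<and> (\<Sum>k<n. c k * f k) = 0 \<longrightarrow> (\<forall>k<n. c k = 0))"

definition spans_over :: "'a::field set \<Rightarrow> nat \<Rightarrow> (nat \<Rightarrow> 'a) \<Rightarrow> bool" where
  "spans_over K n f \<longleftrightarrow> (\<forall>x. \<exists>c. (\<forall>k<n. c k \<in> K) \<and> x = (\<Sum>k<n. c k * f k))"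

context
  fixes K :: "'a::field set"
  assumes K: "subfield K ring_of_type_algebra"
begin

interpretation field "ring_of_type_algebra :: 'a ring" by (rule field_from_type_algebra)

lemma linearly_independent_over_imp_independent:
  assumes ind: "linearly_independent_over K n f"
  shows "independent K (map f [0..<n])"
proof (rule trivial_combine_imp_independent[OF K])
  fix ks
  assume ks: "set ks \<subseteq> K" and sum: "combine ks (map f [0..<n]) = \<zero>\<^bsub>ring_of_type_algebra\<^esub>"
  define c where "c i = (if i < length ks then ks ! i else 0)" for i
  have "(\<Sum>i<n. c i * f i) = (\<Sum>i<min (length ks) n. c i * f i)"
    by (rule sum.mono_neutral_right) (auto simp: c_def)
  also have "\<dots> = 0"
    using sum by (simp add: combine_rta c_def)
  finally have "(\<Sum>i<n. c i * f i) = 0" .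
  moreover have "\<forall>i<n. c i \<in> K"
    using ks subfield_rta_closed(1)[OF K] by (auto simp: c_def)
  ultimately have "\<forall>i<n. c i = 0"
    using ind unfolding linearly_independent_over_def by blast
  then show "set (take (length (map f [0..<n])) ks) \<subseteq> {\<zero>\<^bsub>ring_of_type_algebra\<^esub>}"
    by (auto simp: in_set_conv_nth c_def split: if_splits)
qed simp

lemma spans_over_iff: "spans_over K n f \<longleftrightarrow> Span K (map f [0..<n]) = UNIV"
proof -
  have "Span K (map f [0..<n]) = {combine ks (map f [0..<n]) |ks. length ks = n \<and> set ks \<subseteq> K}"
    using Span_eq_combine_set_length_version[OF K, of "map f [0..<n]"] by simp
  also have "\<dots> = {\<Sum>i<n. c i * f i |c. \<forall>k<n. c k \<in> K}" (is "?A = ?B")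
  proof (intro equalityI subsetI)
    fix x assume "x \<in> ?A"
    then obtain ks where ks: "length ks = n" "set ks \<subseteq> K" "x = combine ks (map f [0..<n])"
      by blast
    have "x = (\<Sum>i<n. ks ! i * f i)"
      unfolding ks(3) combine_rta using ks(1) by simp
    moreover have "\<forall>i<n. ks ! i \<in> K"
      using ks(1,2) by auto
    ultimately show "x \<in> ?B" by blast
  next
    fix x assume "x \<in> ?B"
    then obtain c where c: "\<forall>k<n. c k \<in> K" "x = (\<Sum>i<n. c i * f i)"
      by blast
    have "combine (map c [0..<n]) (map f [0..<n]) = x"
      unfolding c(2) combine_rta by simp
    moreover have "length (map c [0..<n]) = n" "set (map c [0..<n]) \<subseteq> K"
      using c(1) by auto
    ultimately show "x \<in> ?A" by blast
  qed
  finally show ?thesis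
    unfolding spans_over_def by blast
qed

lemma dimension_basis:
  assumes "linearly_independent_over K n f" "spans_over K n f"
  shows "dimension n K UNIV"
  using dimensionI[OF K linearly_independent_over_imp_independent[OF assms(1)]] assms(2)
  by (simp add: spans_over_iff del: Span.simps)

lemma independent_dimension_imp_spans:
  assumes "linearly_independent_over K n f" "dimension n K UNIV"
  shows "spans_over K n f"
  using independent_length_eq_dimension[OF K assms(2) linearly_independent_over_imp_independent[OF assms(1)]]
  by (simp add: spans_over_iff del: Span.simps)

lemma dimension_unique_rta: "dimension n K UNIV \<Longrightarrow> dimension m K UNIV \<Longrightarrow> n = m"
  by (rule dimension_is_inj[OF K])

end

lemma Gal_iff: "\<sigma> \<in> Gal K \<longleftrightarrow> comm_ring_hom \<sigma> \<and> bij \<sigma> \<and> (\<forall>x\<in>K. \<sigma> x = x)" for K :: "'a::field set"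
proof -
  have "comm_ring_hom \<sigma>" if "\<forall>x y. \<sigma> (x + y) = \<sigma> x + \<sigma> y" "\<forall>x y. \<sigma> (x * y) = \<sigma> x * \<sigma> y" "\<sigma> 1 = 1" for \<sigma> :: "'a \<Rightarrow> 'a"
  proof -
    have "\<sigma> (0 + 0) = \<sigma> 0 + \<sigma> 0" using that by blast
    then have "\<sigma> 0 + 0 = \<sigma> 0 + \<sigma> 0" by simp
    then have "\<sigma> 0 = 0" using add_left_imp_eq by metis
    then show ?thesis using that by (auto simp: comm_ring_hom_def)
  qed
  then show ?thesis
    by (auto simp: Gal_def ring_iso_def ring_hom_def comm_ring_homD)
qed

text \<open>
  The automorphism that corresponds to the residue class of \<open>1\<close> generates the group.
\<close>

lemma cyclic_Gal_generator:
  fixes K :: "'a::field set"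
  assumes iso: "Gal_group K \<cong> integer_mod_group n" and n: "n > 1"
  obtains \<sigma> where "\<sigma> \<in> Gal K" "Gal K = range (\<lambda>k. \<sigma> ^^ k)" "\<And>k. \<sigma> ^^ k = id \<longleftrightarrow> n dvd k"
proof -
  obtain h where h: "h \<in> iso (Gal_group K) (integer_mod_group n)"
    using iso by (auto simp: is_iso_def)
  have bij: "bij_betw h (Gal K) {0..<int n}"
    using h n by (auto simp: iso_def Gal_group_def carrier_integer_mod_group)
  have mult: "h (\<sigma> \<circ> \<tau>) = (h \<sigma> + h \<tau>) mod int n" if "\<sigma> \<in> Gal K" "\<tau> \<in> Gal K" for \<sigma> \<tau>
    using h that by (auto simp: iso_def hom_def Gal_group_def)
  have id: "id \<in> Gal K"
    by (simp add: Gal_iff comm_ring_hom_def)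
  have range: "h \<sigma> \<in> {0..<int n}" if "\<sigma> \<in> Gal K" for \<sigma>
    using bij that by (auto simp: bij_betw_def)
  have "h id = (h id + h id) mod int n"
    using mult[OF id id] by simp
  then have "(h id + h id) mod int n = h id mod int n"
    using range[OF id] by simp
  then have "int n dvd h id"
    by (simp add: mod_eq_dvd_iff)
  then have h_id: "h id = 0"
    using range[OF id] by (simp add: zdvd_not_zless order.order_iff_strict) (auto dest: zdvd_not_zless)
  obtain \<sigma> where \<sigma>: "\<sigma> \<in> Gal K" "h \<sigma> = 1"
    using bij n unfolding bij_betw_def by (metis (no_types, lifting) atLeastLessThan_iff image_iff of_nat_1 of_nat_less_iff zero_le_one)
  have pow: "\<sigma> ^^ k \<in> Gal K" for k
  proof -
    have "(\<sigma> ^^ k) x = x" if "x \<in> K" for x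
      using \<sigma>(1) that by (induction k) (auto simp: Gal_iff)
    then show ?thesis
      using \<sigma>(1) by (auto simp: Gal_iff comm_ring_hom_funpow bij_fn)
  qed
  have h_pow: "h (\<sigma> ^^ k) = int k mod int n" for k
  proof (induction k)
    case (Suc k)
    have "h (\<sigma> ^^ Suc k) = (1 + int k mod int n) mod int n"
      unfolding funpow.simps(2) by (simp only: mult[OF \<sigma>(1) pow] \<sigma>(2) Suc)
    then show ?case
      by (simp only: mod_simps of_nat_Suc)
  qed (simp add: h_id flip: id_def)
  have inj: "\<tau> = \<rho>" if "\<tau> \<in> Gal K" "\<rho> \<in> Gal K" "h \<tau> = h \<rho>" for \<tau> \<rho>
    using bij that by (auto simp: bij_betw_def inj_on_def)
  have "\<sigma> ^^ k = id \<longleftrightarrow> n dvd k" for k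
  proof -
    have "\<sigma> ^^ k = id \<longleftrightarrow> int k mod int n = 0"
      using inj[OF pow id, of k] h_pow[of k] h_id by metis
    then show ?thesis
      by (simp flip: of_nat_mod add: dvd_eq_mod_eq_0)
  qed
  moreover have "Gal K = range (\<lambda>k. \<sigma> ^^ k)"
  proof (intro equalityI subsetI)
    fix \<tau> assume \<tau>: "\<tau> \<in> Gal K"
    then have "h \<tau> = h (\<sigma> ^^ nat (h \<tau>))"
      using range[OF \<tau>] by (simp add: h_pow)
    then show "\<tau> \<in> range (\<lambda>k. \<sigma> ^^ k)"
      using inj[OF \<tau> pow] by auto
  qed (use pow in auto)
  ultimately show ?thesis
    using that \<sigma>(1) by blast
qed

lemma nat_pow_rta: "x [^]\<^bsub>ring_of_type_algebra\<lparr>carrier := A\<rparr>\<^esub> (n::nat) = x ^ n" for x :: "'a::field"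
  by (induction n) (simp_all add: ring_of_type_algebra_def nat_pow_def mult.commute)

text \<open>
  On \<open>K\<close> the valuation \<open>w\<close> of the large field is \<open>e\<close> times \<open>v\<close>, so closure properties of its balls
  carry over.
\<close>

lemma valuation_ring_closed:
  fixes K :: "'a::field set"
  assumes v: "discrete_valuation w" and K: "subfield K ring_of_type_algebra"
    and ge: "\<And>x n. x \<in> K \<Longrightarrow> val_ge v n x \<longleftrightarrow> val_ge w (e * n) x" and e: "e > 0"
  shows "ring (ring_of_type_algebra\<lparr>carrier := valuation_ring K v\<rparr>)" (is "ring ?R")
    and "ideal (valuation_ideal K v) (ring_of_type_algebra\<lparr>carrier := valuation_ring K v\<rparr>)"
proof -
  interpret discrete_valuation w by (rule v)
  interpret L: field "ring_of_type_algebra :: 'a ring" by (rule field_from_type_algebra)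
  note c = subfield_rta_closed[OF K]
  have R: "x \<in> valuation_ring K v \<longleftrightarrow> x \<in> K \<and> val_ge w 0 x" for x
    using ge[of x 0] by (auto simp: valuation_ring_def)
  have I: "x \<in> valuation_ideal K v \<longleftrightarrow> x \<in> K \<and> val_ge w e x" for x
    using ge[of x 1] by (auto simp: valuation_ideal_def)
  have sub: "x \<in> valuation_ring K v" if "x \<in> valuation_ideal K v" for x
    using that val_ge_mono[of w e x 0] e by (auto simp: R I)
  have "subring (valuation_ring K v) ring_of_type_algebra"
    by (rule L.subringI) (auto simp: R c val_ge_add val_ge_minus val_ge_mult_int)
  then show ring: "ring ?R"
    by (rule L.subring_is_ring)
  have "subgroup (valuation_ideal K v) (add_monoid ?R)"
  proof
    interpret ring ?R by (rule ring)
    have a_inv: "\<ominus>\<^bsub>?R\<^esub> x = - x" if "x \<in> valuation_ring K v" for x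
      by (rule minus_equality) (use that in \<open>auto simp: R c val_ge_minus\<close>)
    fix x assume x: "x \<in> valuation_ideal K v"
    then have "x \<in> valuation_ring K v"
      by (rule sub)
    then show "inv\<^bsub>add_monoid ?R\<^esub> x \<in> valuation_ideal K v"
      using a_inv x by (auto simp: a_inv_def I c val_ge_minus)
  qed (use sub in \<open>auto simp: I c val_ge_add\<close>)
  then show "ideal (valuation_ideal K v) ?R"
    by (intro idealI ring) (use val_ge_mult[of e _ 0] val_ge_mult_int in \<open>auto simp: R I c\<close>)
qed

text \<open>
  Trinomials \<open>x\<^sup>n + a x + b\<close> are general enough for the two uses of the residue field:
  \<open>p\<close>-th roots and Artin-Schreier equations.
\<close>

lemma residue_field_root:
  fixes K :: "'a::field set" and a b :: 'a
  assumes ideal: "ideal (valuation_ideal K v) (ring_of_type_algebra\<lparr>carrier := valuation_ring K v\<rparr>)"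
    and alg: "algebraically_closed (residue_field K v)" and n: "n \<ge> 2"
    and ab: "a \<in> valuation_ring K v" "b \<in> valuation_ring K v"
  obtains x :: 'a where "x \<in> valuation_ring K v" "x ^ n + a * x + b \<in> valuation_ideal K v"
proof -
  let ?R = "ring_of_type_algebra\<lparr>carrier := valuation_ring K v\<rparr>"
  let ?I = "valuation_ideal K v"
  interpret I: ideal ?I ?R by (rule ideal)
  interpret k: algebraically_closed "residue_field K v" by (rule alg)
  have res: "residue_field K v = ?R Quot ?I"
    by (simp add: residue_field_def)
  interpret h: ring_hom_ring ?R "residue_field K v" "\<lambda>x. ?I +>\<^bsub>?R\<^esub> x"
    by (rule ring_hom_ringI2) (use I.rcos_ring_hom in \<open>simp_all add: res I.ring_axioms I.quotient_is_ring\<close>)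
  obtain m where m: "n = m + 2"
    using n le_Suc_ex add.commute by metis
  define q where "q = [1] @ (replicate (n - 2) 0 @ [a, b])"
  let ?q = "map (\<lambda>x. ?I +>\<^bsub>?R\<^esub> x) q"
  have zero: "0 \<in> valuation_ring K v" and one: "1 \<in> valuation_ring K v"
    using I.zero_closed I.one_closed by auto
  have q: "set q \<subseteq> carrier ?R"
    using ab zero one by (auto simp: q_def)
  have "set ?q \<subseteq> carrier (residue_field K v)"
    using q h.hom_closed by auto
  moreover have "hd ?q = \<one>\<^bsub>residue_field K v\<^esub>"
    using h.hom_one by (simp add: q_def)
  ultimately have "?q \<in> carrier (poly_ring (residue_field K v))"
    using k.one_not_zero unfolding univ_poly_carrier[symmetric] polynomial_def by simp
  then have "k.splitted ?q" "?q \<in> carrier (poly_ring (residue_field K v))"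
    using k.roots_over_carrier by auto
  moreover have "length ?q - 1 = n"
    using n by (simp add: q_def)
  ultimately have "size (k.roots ?q) = n"
    by (simp add: k.splitted_def)
  then have "k.roots ?q \<noteq> {#}"
    using n by auto
  then obtain y where "y \<in># k.roots ?q"
    by auto
  then have "k.is_root ?q y"
    using k.roots_mem_iff_is_root[OF \<open>?q \<in> carrier (poly_ring (residue_field K v))\<close>] by simp
  then have y: "y \<in> carrier (residue_field K v)" "k.eval ?q y = \<zero>\<^bsub>residue_field K v\<^esub>"
    by (auto simp: k.is_root_def)
  then obtain x where x: "x \<in> valuation_ring K v" "y = ?I +>\<^bsub>?R\<^esub> x"
    by (auto simp: res FactRing_def A_RCOSETS_def')
  have "?I +>\<^bsub>?R\<^esub> (I.eval q x) = k.eval ?q (?I +>\<^bsub>?R\<^esub> x)"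
    by (rule h.eval_hom') (use x q in auto)
  then have "?I +>\<^bsub>?R\<^esub> (I.eval q x) = ?I"
    using y x by (simp add: res FactRing_def)
  moreover have "I.eval q x \<in> carrier ?R"
    by (rule I.eval_in_carrier) (use x q in auto)
  ultimately have "I.eval q x \<in> ?I"
    using I.a_rcos_self by blast
  moreover have "I.eval (replicate (n - 2) 0 @ [a, b]) x = I.eval [a, b] x"
    using I.eval_replicate[of "[a, b]" x "n - 2"] ab x by simp
  then have "I.eval q x = x ^ n + a * x + b"
    using m ab x by (simp add: q_def nat_pow_rta add.assoc mult_ac)
  ultimately show ?thesis
    using that x by simp
qed

section \<open>The nilpotent operator \<open>\<sigma> - 1\<close> of a cyclic extension of degree \<open>p\<^sup>2\<close>\<close>

definition delta :: "('a \<Rightarrow> 'a) \<Rightarrow> 'a \<Rightarrow> 'a::comm_ring_1" where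
  "delta f x = f x - x"

context
  fixes f :: "'a::comm_ring_1 \<Rightarrow> 'a"
  assumes f: "comm_ring_hom f"
begin

lemma delta_pow_add: "(delta f ^^ k) (x + y) = (delta f ^^ k) x + (delta f ^^ k) y"
  by (induction k) (simp_all add: delta_def comm_ring_homD[OF f])

lemma delta_pow_0 [simp]: "(delta f ^^ k) 0 = 0"
  by (induction k) (simp_all add: delta_def comm_ring_homD[OF f])

lemma delta_pow_sum: "(delta f ^^ k) (sum g I) = (\<Sum>i\<in>I. (delta f ^^ k) (g i))"
  by (induction I rule: infinite_finite_induct) (simp_all add: delta_pow_add)

lemma delta_pow_scale: "f c = c \<Longrightarrow> (delta f ^^ k) (c * x) = c * (delta f ^^ k) x"
  by (induction k) (simp_all add: delta_def comm_ring_homD[OF f] algebra_simps)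

lemma delta_pow_fixed: "f c = c \<Longrightarrow> k > 0 \<Longrightarrow> (delta f ^^ k) c = 0"
  by (cases k) (simp_all add: funpow_swap1 delta_def)

lemma funpow_eq_sum_delta: "(f ^^ k) x = (\<Sum>i\<le>k. of_nat (k choose i) * (delta f ^^ i) x)"
proof (induction k)
  case (Suc k)
  define g where "g i = (delta f ^^ i) x" for i
  have D: "delta f (of_nat c * g i) = of_nat c * g (Suc i)" for c i
    using delta_pow_scale[of "of_nat c" 1 "g i"] comm_ring_homD(8)[OF f, of c] by (simp add: g_def)
  have "(f ^^ Suc k) x = (f ^^ k) x + delta f ((f ^^ k) x)"
    by (simp add: delta_def)
  also have "delta f ((f ^^ k) x) = (\<Sum>i\<le>k. of_nat (k choose i) * g (Suc i))"
    using delta_pow_sum[of 1 "\<lambda>i. of_nat (k choose i) * g i" "{..k}"] by (simp add: Suc D flip: g_def)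
  also have "(f ^^ k) x = (\<Sum>i\<le>Suc k. of_nat (k choose i) * g i)"
    by (simp add: Suc g_def binomial_eq_0)
  also have "\<dots> = g 0 + (\<Sum>i\<le>k. of_nat (k choose Suc i) * g (Suc i))"
    by (subst sum.atMost_Suc_shift) simp
  also have "\<dots> + (\<Sum>i\<le>k. of_nat (k choose i) * g (Suc i))
      = (\<Sum>i\<le>Suc k. of_nat (Suc k choose i) * g i)"
    by (subst sum.atMost_Suc_shift) (simp add: sum.distrib algebra_simps)
  finally show ?case
    by (simp add: g_def)
qed simp

text \<open>
  By \<open>funpow_eq_sum_delta\<close>, which is the expansion of \<open>(1 + delta f)\<^sup>k\<close>, the inner binomial
  coefficients vanish in characteristic \<open>p\<close>.
\<close>

lemma delta_funpow_char:
  assumes p: "Factorial_Ring.prime p" and char: "CHAR('a) = p"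
  shows "delta (f ^^ p) = delta f ^^ p"
proof
  fix x
  let ?g = "\<lambda>i. of_nat (p choose i) * (delta f ^^ i) x"
  have "(\<Sum>i\<le>p. ?g i) = (\<Sum>i\<in>{0, p}. ?g i)"
  proof (intro sum.mono_neutral_right ballI)
    fix i assume "i \<in> {..p} - {0, p}"
    then have "p dvd (p choose i)"
      using p by (intro dvd_choose_prime) auto
    then have "(of_nat (p choose i) :: 'a) = 0"
      by (simp only: of_nat_eq_0_iff_char_dvd char)
    then show "?g i = 0" by simp
  qed auto
  also have "\<dots> = x + (delta f ^^ p) x"
    using p by (simp add: prime_gt_0_nat)
  finally show "delta (f ^^ p) x = (delta f ^^ p) x"
    by (simp add: delta_def funpow_eq_sum_delta)
qed

text \<open>
  On powers of an element with \<open>f a = a + 1\<close> the operator is the forward difference, which lowers the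
  degree by one and multiplies the leading coefficient by the degree.
\<close>

lemma delta_pow_power:
  assumes a: "f a = a + 1" and "j \<le> k"
  shows "(delta f ^^ k) (a ^ j) = (if k = j then of_nat (fact j) else 0)"
  using assms(2)
proof (induction j arbitrary: k rule: less_induct)
  case (less j)
  show ?case
  proof (cases "j = 0")
    case True
    then show ?thesis
      using delta_pow_fixed[of 1 k] comm_ring_homD(2)[OF f] by auto
  next
    case False
    then obtain i where j: "j = Suc i" by (cases j) auto
    obtain l where k: "k = Suc l" using less.prems j by (cases k) auto
    have "(a + 1) ^ j = (\<Sum>i\<le>j. of_nat (j choose i) * a ^ i)"
      using binomial_ring[of a 1 j] by simp
    also have "\<dots> = a ^ j + (\<Sum>i<j. of_nat (j choose i) * a ^ i)"
      by (simp add: lessThan_Suc_atMost[symmetric])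
    finally have "delta f (a ^ j) = (\<Sum>i<j. of_nat (j choose i) * a ^ i)"
      by (simp add: delta_def comm_ring_homD[OF f] a)
    then have "(delta f ^^ k) (a ^ j) = (\<Sum>i<j. of_nat (j choose i) * (delta f ^^ l) (a ^ i))"
      by (simp add: k funpow_swap1 delta_pow_sum delta_pow_scale comm_ring_homD[OF f])
    also have "\<dots> = (\<Sum>i<j. if l = i then of_nat (j choose i) * of_nat (fact i) else 0)"
      using less.prems by (intro sum.cong) (auto simp: less.IH j k)
    also have "\<dots> = (if l < j then of_nat (j choose l) * of_nat (fact l) else 0)"
      by simp
    also have "\<dots> = (if k = j then of_nat (fact j) else 0)"
      using less.prems j k by (auto simp: algebra_simps)
    finally show ?thesis .
  qed
qed

end

text \<open>
  The polynomial \<open>X\<^sup>p - X\<close> has at most \<open>p\<close> roots, and the \<open>p\<close> elements of the prime field are roots.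
\<close>

lemma prime_field_roots:
  fixes x :: "'a::field"
  assumes p: "Factorial_Ring.prime p" and char: "CHAR('a) = p" and x: "x ^ p = x"
  obtains j where "j < p" "x = of_nat j"
proof -
  have p1: "p > 1" using p by (rule prime_gt_1_nat)
  have pr: "Factorial_Ring.prime CHAR('a)" using assms by simp
  define q :: "'a poly" where "q = monom 1 p - monom 1 1"
  have q: "poly q y = y ^ p - y" for y
    by (simp add: q_def poly_monom)
  have "coeff q p = 1"
    using p1 by (simp add: q_def)
  then have q0: "q \<noteq> 0" by auto
  have deg: "Polynomial.degree q \<le> p"
    unfolding q_def using p1 by (intro degree_diff_le) (auto simp: degree_monom_le intro: order_trans[OF degree_monom_le])
  define P where "P = (of_nat ` {..<p} :: 'a set)"
  note nat = of_nat_power_char[OF p char]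
  have "inj_on (of_nat :: nat \<Rightarrow> 'a) {..<p}"
  proof (rule linorder_inj_onI)
    fix m n :: nat
    assume "m < n" "n \<in> {..<p}"
    then have "\<not> p dvd n - m"
      by (auto dest: dvd_imp_le)
    then have "of_nat (n - m) \<noteq> (0 :: 'a)"
      by (simp add: of_nat_eq_0_iff_char_dvd char)
    then show "of_nat m \<noteq> (of_nat n :: 'a)"
      using \<open>m < n\<close> by (simp add: of_nat_diff)
  qed auto
  then have card: "card P = p"
    by (simp add: P_def card_image)
  have sub: "P \<subseteq> {y. poly q y = 0}"
    by (auto simp: P_def q nat)
  have "finite {y. poly q y = 0}" "card {y. poly q y = 0} \<le> p"
    using poly_roots_finite[OF q0] card_poly_roots_bound[OF q0] deg by auto
  then have "P = {y. poly q y = 0}"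
    using card_seteq[OF _ sub] card by simp
  moreover have "x \<in> {y. poly q y = 0}"
    using x by (simp add: q)
  ultimately show ?thesis
    using that by (auto simp: P_def)
qed

locale cyclic_p_squared =
  fixes K :: "'a::field set" and p :: nat and \<sigma> :: "'a \<Rightarrow> 'a"
  assumes p: "Factorial_Ring.prime p" and char: "CHAR('a) = p"
    and hom: "comm_ring_hom \<sigma>"
    and fixed_iff: "\<sigma> x = x \<longleftrightarrow> x \<in> K"
    and order: "\<sigma> ^^ k = id \<longleftrightarrow> p ^ 2 dvd k"
begin

lemma char_prime: "Factorial_Ring.prime CHAR('a)"
  using p char by simp

lemma p_gt_1: "p > 1"
  using p by (rule prime_gt_1_nat)

lemma of_nat_p [simp]: "of_nat p = (0 :: 'a)"
  using of_nat_CHAR[where 'a = 'a] char by simp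

lemma frobenius_add: "(x + y :: 'a) ^ p = x ^ p + y ^ p"
  by (rule freshmans_dream[OF char_prime char[symmetric]])

lemma frobenius_diff: "(x - y :: 'a) ^ p = x ^ p - y ^ p"
  using frobenius_add[of "x - y" y] by simp

lemmas \<sigma>_simps = comm_ring_homD[OF hom] comm_ring_hom_divide[OF hom]
lemmas \<sigma>_pow_simps = comm_ring_homD[OF comm_ring_hom_funpow[OF hom]]

lemma K_closed:
  "0 \<in> K" "1 \<in> K" "x \<in> K \<Longrightarrow> y \<in> K \<Longrightarrow> x + y \<in> K" "x \<in> K \<Longrightarrow> y \<in> K \<Longrightarrow> x - y \<in> K"
  "x \<in> K \<Longrightarrow> y \<in> K \<Longrightarrow> x * y \<in> K" "x \<in> K \<Longrightarrow> y \<in> K \<Longrightarrow> x / y \<in> K" "x \<in> K \<Longrightarrow> - x \<in> K"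
  "x \<in> K \<Longrightarrow> x ^ n \<in> K" "of_nat n \<in> K"
  by (simp_all add: \<sigma>_simps flip: fixed_iff)

lemma \<sigma>_pow_fixed: "x \<in> K \<Longrightarrow> (\<sigma> ^^ k) x = x"
  by (induction k) (simp_all add: fixed_iff)

abbreviation D :: "'a \<Rightarrow> 'a" where "D \<equiv> delta \<sigma>"

lemma D_eq_0_iff: "D x = 0 \<longleftrightarrow> x \<in> K"
  by (simp add: delta_def fixed_iff)

lemma D_pow_scale: "c \<in> K \<Longrightarrow> (D ^^ k) (c * x) = c * (D ^^ k) x"
  by (rule delta_pow_scale[OF hom]) (simp add: fixed_iff)

lemmas D_pow_add = delta_pow_add[OF hom]
lemmas D_pow_sum = delta_pow_sum[OF hom]
lemmas D_pow_0 [simp] = delta_pow_0[OF hom]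

lemma D_pow_diff: "(D ^^ k) (x - y) = (D ^^ k) x - (D ^^ k) y"
  using D_pow_add[of k x "- y"] D_pow_scale[of "- 1" k y] K_closed by simp

lemma D_pow_p: "D ^^ p = delta (\<sigma> ^^ p)"
  by (rule delta_funpow_char[OF hom p char, symmetric])

lemma D_nilpotent: "(D ^^ (p ^ 2)) x = 0"
proof -
  have "D ^^ (p ^ 2) = (D ^^ p) ^^ p"
    by (simp add: funpow_mult power2_eq_square)
  also have "\<dots> = delta ((\<sigma> ^^ p) ^^ p)"
    unfolding D_pow_p by (rule delta_funpow_char[OF comm_ring_hom_funpow[OF hom] p char, symmetric])
  also have "(\<sigma> ^^ p) ^^ p = id"
    using order by (simp add: funpow_mult power2_eq_square)
  finally have "(D ^^ (p ^ 2)) x = delta id x"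
    by (rule fun_cong)
  also have "\<dots> = 0"
    by (simp add: delta_def)
  finally show ?thesis .
qed

text \<open>
  Let \<open>m\<close> be the length of the chain \<open>z, D z, D (D z), \<dots>\<close> started at an element that is not fixed by
  \<open>\<sigma>\<^sup>p\<close>. It ends in \<open>K\<close>, and \<open>m > p\<close> because \<open>D\<^sup>p z \<noteq> 0\<close>. After scaling, its end is \<open>1\<close>, so the chain
  contains, for each \<open>k < m\<close>, an element on which \<open>D\<^sup>k\<close> takes the value \<open>1\<close>. An element killed by \<open>D\<^sup>k\<^sup>+\<^sup>1\<close>
  is changed by a \<open>K\<close>-multiple of it into one killed by \<open>D\<^sup>k\<close>; as long as \<open>k < m - 1\<close> the
  multiple is itself in the image of \<open>D\<close>. Elements fixed by \<open>\<sigma>\<^sup>p\<close> are killed by \<open>D\<^sup>p\<close>.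
\<close>

lemma additive_hilbert90:
  assumes x: "(\<sigma> ^^ p) x = x"
  shows "\<exists>y. D y = x"
proof -
  have "\<not> p ^ 2 dvd p"
    using p_gt_1 by (auto simp: power2_eq_square)
  then have "\<sigma> ^^ p \<noteq> id"
    using order by simp
  then obtain z where z: "(D ^^ p) z \<noteq> 0"
    by (auto simp: D_pow_p delta_def fun_eq_iff)
  define m where "m = (LEAST m. (D ^^ m) z = 0)"
  have m: "(D ^^ m) z = 0"
    unfolding m_def by (rule LeastI[of _ "p ^ 2"]) (rule D_nilpotent)
  have least: "(D ^^ k) z \<noteq> 0" if "k < m" for k
    using not_less_Least that unfolding m_def by blast
  have "p < m"
  proof (rule ccontr)
    assume "\<not> p < m"
    then have "(D ^^ p) z = (D ^^ (p - m)) ((D ^^ m) z)"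
      by (simp flip: comp_apply[of "D ^^ (p - m)"] funpow_add)
    then show False using z m by simp
  qed
  then obtain n where n: "m = Suc n" "p \<le> n"
    by (cases m) auto
  \<comment> \<open>The last nonzero element of the chain lies in \<open>K\<close> and can be divided out.\<close>
  define c where "c = (D ^^ n) z"
  have c: "c \<noteq> 0" "c \<in> K"
    using m least[of n] n D_eq_0_iff by (auto simp: c_def)
  define \<theta> where "\<theta> = (1 / c) * z"
  have "(D ^^ n) \<theta> = 1"
    unfolding \<theta>_def using c K_closed by (subst D_pow_scale) (auto simp: c_def)
  then have \<theta>: "(D ^^ k) ((D ^^ (n - k)) \<theta>) = 1" if "k \<le> n" for k
    using that by (simp flip: comp_apply[of "D ^^ k"] funpow_add)
  have "\<exists>y. D y = x" if "(D ^^ k) x = 0" "k \<le> n" for k x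
    using that
  proof (induction k arbitrary: x)
    case 0
    then show ?case using D_pow_0[of 1] by auto
  next
    case (Suc k)
    let ?d = "(D ^^ k) x"
    have d: "?d \<in> K"
      using Suc.prems by (simp flip: D_eq_0_iff)
    have "(D ^^ k) (x - ?d * (D ^^ (n - k)) \<theta>) = 0"
      using \<theta>[of k] Suc.prems by (simp add: D_pow_diff D_pow_scale[OF d])
    then obtain y where y: "D y = x - ?d * (D ^^ (n - k)) \<theta>"
      using Suc by auto
    have "D ((D ^^ (n - Suc k)) \<theta>) = (D ^^ (n - k)) \<theta>"
      using Suc.prems by (metis Suc_diff_Suc Suc_le_lessD comp_apply funpow.simps(2))
    then have "D (y + ?d * (D ^^ (n - Suc k)) \<theta>) = x"
      using D_pow_add[of 1] D_pow_scale[OF d, of 1] y by simp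
    then show ?case by blast
  qed
  moreover have "(D ^^ p) x = 0"
    using x by (simp add: D_pow_p delta_def)
  ultimately show ?thesis
    using n(2) by blast
qed

lemma \<sigma>_pow_a0: "\<sigma> a0 = a0 + 1 \<Longrightarrow> (\<sigma> ^^ k) a0 = a0 + of_nat k"
  by (induction k) (simp_all add: \<sigma>_simps)

text \<open>
  For \<open>s = 0\<close> the hypotheses say that \<open>\<sigma>\<close> adds the Witt vector \<open>(1, 0)\<close> to \<open>(a0, a1)\<close>. A generator that is
  given in advance leads to some \<open>s\<close> in the prime field instead.
\<close>

lemma \<sigma>_pow_a1:
  assumes a0: "\<sigma> a0 = a0 + 1" and a1: "\<sigma> a1 = a1 + witt2_carry p a0 1 + s" and s: "s \<in> K"
  shows "(\<sigma> ^^ k) a1 = a1 + (\<Sum>j<k. witt2_carry p (a0 + of_nat j) 1) + of_nat k * s"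
proof (induction k)
  case (Suc k)
  have "(\<sigma> ^^ Suc k) a1 = (\<sigma> ^^ k) (a1 + witt2_carry p a0 1 + s)"
    by (simp add: funpow_swap1 a1)
  also have "\<dots> = (\<sigma> ^^ k) a1 + witt2_carry p (a0 + of_nat k) 1 + s"
    by (simp add: \<sigma>_pow_simps witt2_carry_hom[OF comm_ring_hom_funpow[OF hom]] \<sigma>_pow_a0[OF a0] \<sigma>_pow_fixed[OF s])
  finally show ?case
    by (simp add: Suc algebra_simps)
qed simp

lemma \<sigma>_pow_p_a1:
  assumes "\<sigma> a0 = a0 + 1" and "\<sigma> a1 = a1 + witt2_carry p a0 1 + s" and "s \<in> K"
  shows "(\<sigma> ^^ p) a1 = a1 + 1"
  using \<sigma>_pow_a1[OF assms, of p] sum_witt2_carry_translates[OF p, of a0] by simp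

lemma exists_a0: "\<exists>a0. \<sigma> a0 = a0 + 1"
  using additive_hilbert90[of 1] by (auto simp: \<sigma>_pow_simps delta_def diff_eq_eq add.commute)

lemma exists_a1:
  assumes a0: "\<sigma> a0 = a0 + 1"
  shows "\<exists>a1. \<sigma> a1 = a1 + witt2_carry p a0 1"
proof -
  have "(\<sigma> ^^ p) (witt2_carry p a0 1) = witt2_carry p a0 1"
    by (simp add: witt2_carry_hom[OF comm_ring_hom_funpow[OF hom]] \<sigma>_pow_a0[OF a0] \<sigma>_pow_simps)
  from additive_hilbert90[OF this] show ?thesis
    by (auto simp: delta_def diff_eq_eq add.commute)
qed

text \<open>
  Let \<open>\<alpha>1\<close> be the second component of the image of \<open>(a0, a1)\<close> under Frobenius minus identity. It is fixed
  by \<open>\<sigma>\<close> exactly if \<open>\<sigma>\<close> adds to \<open>(a0, a1)\<close> a Witt vector \<open>(1, s)\<close> with \<open>s\<close> in the prime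
  field. One direction shows that the vector constructed below descends to \<open>K\<close>, the other one describes
  the action of \<open>\<sigma>\<close> on a given generator.
\<close>

lemma artin_schreier_witt_shift:
  assumes a0: "\<sigma> a0 = a0 + 1" and \<alpha>0: "a0 ^ p - a0 \<in> K"
  shows "delta \<sigma> (a1 ^ p - a1 - witt2_carry p (a0 ^ p - a0) a0)
    = (\<sigma> a1 - a1 - witt2_carry p a0 1) ^ p - (\<sigma> a1 - a1 - witt2_carry p a0 1)"
proof -
  let ?\<alpha> = "a0 ^ p - a0"
  have "witt2_carry p ?\<alpha> a0 + witt2_carry p (a0 ^ p) 1 = witt2_carry p a0 1 + witt2_carry p ?\<alpha> (a0 + 1)"
    using witt2_carry_cocycle[OF p, of ?\<alpha> a0 1] by simp
  moreover have "witt2_carry p a0 1 ^ p = witt2_carry p (a0 ^ p) 1"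
    using witt2_carry_power_char[OF p char, of a0 1] by simp
  moreover have "\<sigma> (witt2_carry p ?\<alpha> a0) = witt2_carry p ?\<alpha> (a0 + 1)"
    using \<alpha>0 by (simp only: witt2_carry_hom[OF hom] a0 flip: fixed_iff)
  ultimately show ?thesis
    by (simp add: delta_def \<sigma>_simps frobenius_diff frobenius_add algebra_simps)
qed

text \<open>
  The power \<open>\<sigma>\<^sup>p\<close> fixes \<open>a0\<close> and translates \<open>a1\<close>, so \<open>D\<^sup>p\<^sup>j\<close> acts on the second factor only and reduces it to
  the constant \<open>j!\<close>. Then \<open>D\<^sup>i\<close> reduces the first factor to \<open>i!\<close>.
\<close>

lemma D_pow_monomial:
  assumes a0: "\<sigma> a0 = a0 + 1" and a1: "(\<sigma> ^^ p) a1 = a1 + 1"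
  shows "(D ^^ (i + p * j)) (a0 ^ i * a1 ^ j) = of_nat (fact i * fact j)"
proof -
  let ?\<tau> = "\<sigma> ^^ p"
  have \<tau>: "comm_ring_hom ?\<tau>"
    by (rule comm_ring_hom_funpow[OF hom])
  have "?\<tau> (a0 ^ i) = a0 ^ i"
    by (simp add: \<sigma>_pow_a0[OF a0] \<sigma>_pow_simps)
  then have "(delta ?\<tau> ^^ j) (a0 ^ i * a1 ^ j) = a0 ^ i * of_nat (fact j)"
    using delta_pow_scale[OF \<tau>, of "a0 ^ i" j "a1 ^ j"] delta_pow_power[OF \<tau> a1, of j j] by simp
  moreover have "D ^^ (p * j) = delta ?\<tau> ^^ j"
    by (simp add: D_pow_p[symmetric] funpow_mult mult.commute)
  moreover have "(D ^^ i) (a0 ^ i * of_nat (fact j)) = of_nat (fact i * fact j)"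
    using D_pow_scale[of "of_nat (fact j)" i "a0 ^ i"] delta_pow_power[OF hom a0, of i i] K_closed
    by (simp add: mult.commute)
  ultimately show ?thesis
    by (simp add: funpow_add)
qed

text \<open>
  If \<open>D\<^sup>k\<^sup>+\<^sup>1 x = 0\<close> then \<open>D\<^sup>k x\<close> is in \<open>K\<close>, and subtracting a \<open>K\<close>-multiple of \<open>f k\<close> leaves an element
  killed by \<open>D\<^sup>k\<close>.
\<close>

lemma nilpotent_ladder_spans:
  assumes f: "\<And>k. k < p ^ 2 \<Longrightarrow> (D ^^ k) (f k) \<in> K - {0}"
    and S: "0 \<in> S" "\<And>x y. x \<in> S \<Longrightarrow> y \<in> S \<Longrightarrow> x + y \<in> S"
    and Sf: "\<And>c k. c \<in> K \<Longrightarrow> k < p ^ 2 \<Longrightarrow> c * f k \<in> S"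
  shows "S = UNIV"
proof -
  have "x \<in> S" if "k \<le> p ^ 2" "(D ^^ k) x = 0" for k x
    using that
  proof (induction k arbitrary: x)
    case (Suc k)
    let ?e = "(D ^^ k) (f k)" and ?d = "(D ^^ k) x"
    have e: "?e \<in> K" "?e \<noteq> 0"
      using f[of k] Suc.prems by auto
    have "?d \<in> K"
      using Suc.prems by (simp flip: D_eq_0_iff)
    then have c: "?d / ?e \<in> K"
      using e K_closed by simp
    have "(D ^^ k) (x - (?d / ?e) * f k) = 0"
      unfolding D_pow_diff D_pow_scale[OF c] using e by simp
    then have "x - (?d / ?e) * f k \<in> S"
      using Suc by simp
    from S(2)[OF this Sf[OF c, of k]] show ?case
      using Suc.prems by simp
  qed (use S in simp)
  then show ?thesis
    using D_nilpotent by blast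
qed

text \<open>
  The operator \<open>D\<^sup>n\<^sup>-\<^sup>1\<close> kills all terms of the sum but the last.
\<close>

lemma nilpotent_ladder_independent:
  assumes f: "\<And>k. k < n \<Longrightarrow> (D ^^ k) (f k) \<in> K - {0}"
    and c: "\<And>k. k < n \<Longrightarrow> c k \<in> K" and sum: "(\<Sum>k<n. c k * f k) = 0"
  shows "k < n \<Longrightarrow> c k = 0"
  using assms
proof (induction n)
  case (Suc n)
  have lower: "(D ^^ n) (f k) = 0" if "k < n" for k
  proof -
    have "(D ^^ Suc k) (f k) = 0"
      using Suc.prems(2)[of k] that by (simp add: D_eq_0_iff)
    moreover have "n = (n - Suc k) + Suc k"
      using that by simp
    ultimately show ?thesis
      by (metis D_pow_0 comp_apply funpow_add)
  qed
  have "(D ^^ n) (\<Sum>k<Suc n. c k * f k) = (\<Sum>k<Suc n. c k * (D ^^ n) (f k))"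
    unfolding D_pow_sum by (intro sum.cong D_pow_scale Suc.prems) auto
  also have "\<dots> = c n * (D ^^ n) (f n)"
    using lower by simp
  finally have cn: "c n = 0"
    using Suc.prems(2)[of n] Suc.prems(4) by simp
  show ?case
  proof (cases "k = n")
    case False
    then show ?thesis
      using Suc.prems cn by (intro Suc.IH) (auto simp: less_Suc_eq)
  qed (simp add: cn)
qed simp

context
  fixes a0 a1 :: 'a
  assumes a0: "\<sigma> a0 = a0 + 1" and a1: "(\<sigma> ^^ p) a1 = a1 + 1"
begin

lemma monomial_ladder:
  assumes k: "k < p ^ 2"
  shows "(D ^^ k) (a0 ^ (k mod p) * a1 ^ (k div p)) \<in> K - {0}"
proof -
  have less: "k mod p < p" "k div p < p"
    using k p_gt_1 by (simp_all add: less_mult_imp_div_less power2_eq_square)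
  have "k = k mod p + p * (k div p)"
    by simp
  then have "(D ^^ k) (a0 ^ (k mod p) * a1 ^ (k div p)) = of_nat (fact (k mod p) * fact (k div p))"
    using D_pow_monomial[OF a0 a1, of "k mod p" "k div p"] by metis
  moreover have "\<not> p dvd fact (k mod p) * fact (k div p)"
    unfolding prime_dvd_mult_iff[OF p] prime_dvd_fact_iff[OF p] using less by linarith
  ultimately show ?thesis
    by (simp only: of_nat_eq_0_iff_char_dvd char K_closed Diff_iff singleton_iff simp_thms)
qed

lemma monomials_dimension:
  assumes K: "subfield K ring_of_type_algebra"
  shows "ring.dimension ring_of_type_algebra (p ^ 2) K UNIV"
proof -
  let ?f = "\<lambda>k. a0 ^ (k mod p) * a1 ^ (k div p)"
  let ?S = "{x. \<exists>c. (\<forall>k<p ^ 2. c k \<in> K) \<and> x = (\<Sum>k<p ^ 2. c k * ?f k)}"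
  have "?S = UNIV"
  proof (rule nilpotent_ladder_spans[OF monomial_ladder])
    show "0 \<in> ?S"
      using K_closed(1) by (intro CollectI exI[of _ "\<lambda>_. 0"]) simp
  next
    fix x y assume "x \<in> ?S" "y \<in> ?S"
    then obtain c d where "\<forall>k<p ^ 2. c k \<in> K" "x = (\<Sum>k<p ^ 2. c k * ?f k)"
      "\<forall>k<p ^ 2. d k \<in> K" "y = (\<Sum>k<p ^ 2. d k * ?f k)"
      by blast
    then show "x + y \<in> ?S"
      by (intro CollectI exI[of _ "\<lambda>k. c k + d k"]) (simp add: K_closed distrib_right sum.distrib)
  next
    fix c k assume c: "c \<in> K" and k: "k < p ^ 2"
    have "c * ?f k = (\<Sum>j<p ^ 2. (if j = k then c else 0) * ?f j)"
      using k by (simp add: if_distrib[of "\<lambda>t. t * _"] cong: if_cong)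
    then show "c * ?f k \<in> ?S"
      using c K_closed(1) by (intro CollectI exI[of _ "\<lambda>j. if j = k then c else 0"]) simp
  qed
  then have "spans_over K (p ^ 2) ?f"
    unfolding spans_over_def by blast
  moreover have "linearly_independent_over K (p ^ 2) ?f"
    unfolding linearly_independent_over_def
  proof (intro allI impI)
    fix c k assume "(\<forall>k<p ^ 2. c k \<in> K) \<and> (\<Sum>k<p ^ 2. c k * ?f k) = 0" "k < p ^ 2"
    then show "c k = 0"
      using nilpotent_ladder_independent[where n = "p ^ 2" and f = ?f and c = c and k = k, OF monomial_ladder]
      by blast
  qed
  ultimately show ?thesis
    using dimension_basis[OF K] by blast
qed

lemma monomials_generate: "generate_field ring_of_type_algebra (K \<union> {a0, a1}) = UNIV"
proof (rule nilpotent_ladder_spans[OF monomial_ladder])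
  let ?F = "generate_field ring_of_type_algebra (K \<union> {a0, a1})"
  have add: "x + y \<in> ?F" and mult: "x * y \<in> ?F" if "x \<in> ?F" "y \<in> ?F" for x y
    using generate_field.eng_add[OF that] generate_field.eng_mult[OF that] by simp_all
  have one: "1 \<in> ?F"
    using generate_field.one[of ring_of_type_algebra] by simp
  have pow: "x ^ k \<in> ?F" if "x \<in> ?F" for x k
    by (induction k) (use one mult that in simp_all)
  have incl: "x \<in> ?F" if "x \<in> K \<union> {a0, a1}" for x
    using that by (rule generate_field.incl)
  show "0 \<in> ?F" using incl K_closed by blast
  show "x + y \<in> ?F" if "x \<in> ?F" "y \<in> ?F" for x y by (rule add[OF that])
  show "c * (a0 ^ (k mod p) * a1 ^ (k div p)) \<in> ?F" if "c \<in> K" for c k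
    by (intro mult pow incl) (use that in auto)
qed

end

text \<open>
  If \<open>a0\<close> were in \<open>K\<close>, then \<open>a1\<close> would satisfy an ordinary Artin-Schreier equation over \<open>K\<close>, so that \<open>\<sigma>\<^sup>p\<close> would be
  trivial on \<open>K(a0, a1) = L\<close>.
\<close>

lemma generator_moves_a0:
  assumes gen: "generate_field ring_of_type_algebra (K \<union> {a0, a1}) = UNIV"
    and \<alpha>: "a1 ^ p - a1 - witt2_carry p (a0 ^ p - a0) a0 \<in> K"
  shows "a0 \<notin> K"
proof
  assume a0: "a0 \<in> K"
  have "witt2_carry p (a0 ^ p - a0) a0 \<in> K"
    unfolding fixed_iff[symmetric] witt2_carry_hom[OF hom] using a0 by (simp add: \<sigma>_simps flip: fixed_iff)
  from K_closed(3)[OF \<alpha> this] have "a1 ^ p - a1 \<in> K"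
    by simp
  then have "\<sigma> (a1 ^ p - a1) = a1 ^ p - a1"
    by (simp only: fixed_iff)
  then have "(\<sigma> a1 - a1) ^ p = \<sigma> a1 - a1"
    by (simp add: \<sigma>_simps frobenius_diff algebra_simps)
  then obtain j where j: "\<sigma> a1 - a1 = of_nat j"
    using prime_field_roots[OF p char] by metis
  then have \<sigma>a1: "\<sigma> a1 = a1 + of_nat j"
    by (simp add: algebra_simps)
  have "(\<sigma> ^^ k) a1 = a1 + of_nat k * of_nat j" for k
    by (induction k) (simp_all add: \<sigma>_simps \<sigma>a1 algebra_simps)
  from this[of p] have a1: "(\<sigma> ^^ p) a1 = a1"
    by simp
  have "(\<sigma> ^^ p) x = x" if "x \<in> generate_field ring_of_type_algebra (K \<union> {a0, a1})" for x
    using that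
  proof (induction rule: generate_field.induct)
    case (incl h)
    then show ?case using a0 a1 \<sigma>_pow_fixed by auto
  next
    case (m_inv h)
    then have "(\<sigma> ^^ p) (1 / h) = 1 / h"
      by (simp only: comm_ring_hom_divide[OF comm_ring_hom_funpow[OF hom]] \<sigma>_pow_simps)
    then show ?case using m_inv by (simp add: inverse_eq_divide)
  qed (simp_all add: \<sigma>_pow_simps)
  then have "\<sigma> ^^ p = id"
    unfolding gen by (simp add: fun_eq_iff)
  then have "p ^ 2 dvd p"
    using order by simp
  then show False
    using p_gt_1 by (auto simp: power2_eq_square)
qed

end


section \<open>Artin-Schreier equations over the base field\<close>

text \<open>
  The extension is totally ramified, so \<open>v\<close> restricts to \<open>p\<^sup>2\<close> times the valuation of \<open>K\<close>. Elements of
  \<open>K\<close> are measured by \<open>v\<close> as well: the valuation \<open>n\<close> in \<open>K\<close> appears as \<open>e * n\<close>.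
\<close>

locale ramified_cyclic_p_squared = cyclic_p_squared K p \<sigma> + discrete_valuation v
  for K :: "'a::field set" and p :: nat and \<sigma> :: "'a \<Rightarrow> 'a" and v :: "'a \<Rightarrow> int" +
  fixes vK :: "'a \<Rightarrow> int"
  assumes subfield: "subfield K ring_of_type_algebra"
    and vK: "normalized_valuation K vK"
    and complete: "valuation_complete K vK"
    and alg_closed: "algebraically_closed (residue_field K vK)"
    and v_K: "x \<in> K \<Longrightarrow> x \<noteq> 0 \<Longrightarrow> v x = int p ^ 2 * vK x"
begin

definition e :: int where "e = int p ^ 2"

lemma e_pos: "e > 0"
  using p_gt_1 by (simp add: e_def)

lemma e_ge_1: "1 \<le> e"
  using e_pos by linarith

lemma e_eq: "e = int p * int p"
  by (simp add: e_def power2_eq_square)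

lemma has_val_K: "x \<in> K \<Longrightarrow> has_val v (e * n) x \<longleftrightarrow> has_val vK n x"
  using v_K[of x] e_pos by (auto simp: has_val_def e_def)

lemma val_ge_K: "x \<in> K \<Longrightarrow> val_ge vK n x \<longleftrightarrow> val_ge v (e * n) x"
  using v_K[of x] e_pos by (auto simp: val_ge_def e_def)

lemma has_val_vK: "x \<in> K \<Longrightarrow> x \<noteq> 0 \<Longrightarrow> has_val v (e * vK x) x"
  using v_K[of x] by (simp add: has_val_def e_def)

lemma exists_has_val_K: "\<exists>c\<in>K. has_val v (e * n) c"
proof -
  have "n \<in> vK ` (K - {0})"
    using vK by (simp add: normalized_valuation_def)
  then obtain c where "c \<in> K" "has_val vK n c"
    by (auto simp: has_val_def)
  then show ?thesis
    by (auto simp: has_val_K)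
qed

lemma val_ge_K_Suc:
  assumes "x \<in> K" "val_ge v (e * n + 1) x"
  shows "val_ge v (e * (n + 1)) x"
proof (cases "x = 0")
  case False
  define m where "m = vK x"
  have m: "has_val v (e * m) x"
    unfolding m_def by (rule has_val_vK[OF assms(1) False])
  then have "e * n < e * m"
    using assms(2) by (simp add: val_ge_iff_le)
  then have "n + 1 \<le> m"
    using e_pos by simp
  then have "e * (n + 1) \<le> e * m"
    using e_pos by (intro mult_left_mono) auto
  then show ?thesis
    using m by (simp add: val_ge_iff_le)
qed simp

lemma residue_trinomial_root:
  assumes "a \<in> K" "b \<in> K" "val_ge v 0 a" "val_ge v 0 b"
  obtains x where "x \<in> K" "val_ge v 0 x" "val_ge v e (x ^ p + a * x + b)"
proof -
  have R: "x \<in> valuation_ring K vK \<longleftrightarrow> x \<in> K \<and> val_ge v 0 x" for x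
    using val_ge_K[of x 0] by (auto simp: valuation_ring_def)
  have I: "x \<in> valuation_ideal K vK \<longleftrightarrow> x \<in> K \<and> val_ge v e x" for x
    using val_ge_K[of x 1] by (auto simp: valuation_ideal_def)
  have "ideal (valuation_ideal K vK) (ring_of_type_algebra\<lparr>carrier := valuation_ring K vK\<rparr>)"
    by (rule valuation_ring_closed(2)[OF discrete_valuation_axioms subfield val_ge_K e_pos])
  from residue_field_root[OF this alg_closed, of p a b] show ?thesis
    using assms p_gt_1 that by (auto simp: R I)
qed

text \<open>
  Divide by the \<open>p\<close>-th power of an element of the right valuation and take a \<open>p\<close>-th root in the
  residue field.
\<close>

lemma pth_power_approximation:
  assumes "\<alpha> \<in> K" "has_val v (e * (int p * l)) \<alpha>"
  obtains c where "c \<in> K" "has_val v (e * l) c" "val_ge v (e * (int p * l + 1)) (\<alpha> - c ^ p)"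
proof -
  obtain c where c: "c \<in> K" "has_val v (e * l) c"
    using exists_has_val_K by blast
  define u where "u = \<alpha> / c ^ p"
  have cp: "has_val v (e * (int p * l)) (c ^ p)"
    using has_val_power[OF c(2), of p] by (simp add: mult_ac)
  have u: "u \<in> K" "has_val v 0 u"
    using K_closed assms(1) c(1) has_val_divide[OF assms(2) cp] by (simp_all add: u_def)
  have "val_ge v 0 (- u)"
    by (intro val_ge_minus has_val_imp_val_ge[OF u(2)]) simp
  then obtain w where w: "w \<in> K" "val_ge v 0 w" "val_ge v e (w ^ p + 0 * w + (- u))"
    using residue_trinomial_root[of 0 "- u"] u K_closed by auto
  have "has_val v 0 (u + (w ^ p - u))"
    by (rule has_val_add[OF u(2)]) (use val_ge_mono[OF w(3), of 1] e_pos in simp)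
  then have wp: "has_val v 0 (w ^ p)"
    by simp
  then have "w \<noteq> 0"
    using p_gt_1 by (auto simp: has_val_def)
  then have "int p * v w = 0"
    using has_val_power[of "v w" w p] wp by (auto simp: has_val_def)
  then have w0: "has_val v 0 w"
    using \<open>w \<noteq> 0\<close> p_gt_1 by (simp add: has_val_def)
  have "c ^ p \<noteq> 0"
    using cp by (simp add: has_val_def)
  then have "\<alpha> - (c * w) ^ p = c ^ p * - (w ^ p + 0 * w + (- u))"
    by (simp add: u_def algebra_simps)
  moreover have "val_ge v (e * (int p * l) + e) (c ^ p * - (w ^ p + 0 * w + (- u)))"
    by (intro val_ge_mult val_ge_minus w(3) has_val_imp_val_ge[OF cp]) simp
  ultimately have "val_ge v (e * (int p * l + 1)) (\<alpha> - (c * w) ^ p)"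
    by (simp add: algebra_simps)
  moreover have "has_val v (e * l) (c * w)"
    using has_val_mult[OF c(2) w0] by simp
  ultimately show ?thesis
    using that[of "c * w"] K_closed(5)[OF c(1) w(1)] by simp
qed

text \<open>
  As \<open>n0\<close> is coprime to \<open>p\<close>, a power \<open>\<alpha>0 ^ m\<close> with \<open>m < p\<close> adjusts the valuation of \<open>\<alpha>\<close> to a multiple of \<open>p\<close>.
\<close>

lemma leading_term:
  assumes \<alpha>: "\<alpha> \<in> K" "has_val v (- e * n) \<alpha>" and \<alpha>0: "\<alpha>0 \<in> K" "has_val v (- e * n0) \<alpha>0"
    and n0: "coprime n0 (int p)"
  obtains c l m where "c \<in> K" "has_val v (e * l) c" "m < p" "int p * l - int m * n0 = - n"
    "val_ge v (- e * n + e) (\<alpha> - c ^ p * \<alpha>0 ^ m)"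
proof -
  \<comment> \<open>The exponent \<open>m\<close> solves \<open>m * n0 = n\<close> modulo \<open>p\<close>.\<close>
  obtain u w where uw: "u * n0 + w * int p = 1"
    using bezout_int[of n0 "int p"] n0 by (auto simp: coprime_iff_gcd_eq_1)
  define m where "m = nat ((n * u) mod int p)"
  have m: "m < p" "int m = (n * u) mod int p"
    using p_gt_1 by (auto simp: m_def nat_less_iff)
  have "n * u * n0 = n - n * w * int p"
    using uw by (metis add_diff_cancel_right' mult.assoc mult.right_neutral right_diff_distrib' distrib_left)
  moreover have "int m * n0 - n = (n * u * n0 - n) - (n * u) div int p * int p * n0"
    unfolding m(2) minus_div_mult_eq_mod[symmetric] by (simp add: algebra_simps)
  ultimately have "int m * n0 - n = int p * (- n * w - (n * u) div int p * n0)"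
    by (simp add: algebra_simps)
  then obtain l where l: "int m * n0 - n = int p * l"
    by blast
  have \<alpha>0m: "has_val v (int m * (- e * n0)) (\<alpha>0 ^ m)"
    by (rule has_val_power[OF \<alpha>0(2)])
  have "- e * n - int m * (- e * n0) = e * (int p * l)"
    unfolding l[symmetric] by (simp add: algebra_simps)
  then have "has_val v (e * (int p * l)) (\<alpha> / \<alpha>0 ^ m)"
    using has_val_divide[OF \<alpha>(2) \<alpha>0m] by simp
  moreover have "\<alpha> / \<alpha>0 ^ m \<in> K"
    by (intro K_closed \<alpha> \<alpha>0)
  ultimately obtain c
    where c: "c \<in> K" "has_val v (e * l) c" "val_ge v (e * (int p * l + 1)) (\<alpha> / \<alpha>0 ^ m - c ^ p)"
    using pth_power_approximation by blast
  have "e * (int p * l + 1) + int m * (- e * n0) = - e * n + e"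
    unfolding distrib_left l[symmetric] by (simp add: algebra_simps)
  then have "val_ge v (- e * n + e) ((\<alpha> / \<alpha>0 ^ m - c ^ p) * \<alpha>0 ^ m)"
    using val_ge_mult[OF c(3) has_val_imp_val_ge[OF \<alpha>0m order_refl]] by simp
  moreover have "(\<alpha> / \<alpha>0 ^ m - c ^ p) * \<alpha>0 ^ m = \<alpha> - c ^ p * \<alpha>0 ^ m"
    using \<alpha>0m unfolding has_val_def by (metis left_diff_distrib nonzero_eq_divide_eq)
  ultimately have "val_ge v (- e * n + e) (\<alpha> - c ^ p * \<alpha>0 ^ m)"
    by simp
  then show ?thesis
    using that c m(1) l by (simp add: algebra_simps)
qed

text \<open>
  The iteration \<open>x \<mapsto> x\<^sup>p - \<alpha>\<close> is contracting on the maximal ideal, because the difference of two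
  values is the \<open>p\<close>-th power of the difference of the arguments.
\<close>

lemma artin_schreier_small:
  assumes \<alpha>: "\<alpha> \<in> K" "val_ge v 1 \<alpha>"
  shows "\<exists>\<beta>\<in>K. \<beta> ^ p - \<beta> = \<alpha>"
proof -
  define t where "t = rec_nat 0 (\<lambda>_ x. x ^ p - \<alpha>)"
  have t: "t 0 = 0" "t (Suc n) = t n ^ p - \<alpha>" for n
    by (simp_all add: t_def)
  have tK: "t n \<in> K" for n
    by (induction n) (simp_all add: t K_closed \<alpha>(1))
  have step: "val_ge v (int n + 1) (t (Suc n) - t n)" for n
  proof (induction n)
    case 0
    then show ?case
      using p_gt_1 \<alpha>(2) by (simp add: t val_ge_minus zero_power)
  next
    case (Suc n)
    have pth: "t (Suc (Suc n)) - t (Suc n) = (t (Suc n) - t n) ^ p"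
      by (simp add: t(2)[of "Suc n"] frobenius_diff) (simp add: t(2)[of n])
    have "2 * (int n + 1) \<le> int p * (int n + 1)"
      using p_gt_1 by (intro mult_right_mono) auto
    moreover have "int (Suc n) + 1 \<le> 2 * (int n + 1)"
      by simp
    ultimately have "int (Suc n) + 1 \<le> int p * (int n + 1)"
      by (rule order_trans[rotated])
    with pth show ?case
      using val_ge_mono[OF val_ge_power[OF Suc, of p], of "int (Suc n) + 1"] by simp
  qed
  have diff: "val_ge v (int n + 1) (t (n + k) - t n)" for n k
  proof (induction k)
    case (Suc k)
    have "val_ge v (int n + 1) (t (Suc (n + k)) - t (n + k))"
      by (rule val_ge_mono[OF step]) simp
    from val_ge_add[OF this Suc] show ?case
      by simp
  qed simp
  have "range t \<subseteq> K"
    using tK by auto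
  moreover have "\<exists>N. \<forall>i\<ge>N. \<forall>j\<ge>N. val_ge vK n (t i - t j)" for n
  proof (intro exI allI impI)
    fix i j assume ij: "nat (e * n) \<le> i" "nat (e * n) \<le> j"
    have "val_ge v (e * n) (t i - t (nat (e * n)))" if "nat (e * n) \<le> i" for i
      using val_ge_mono[OF diff[of "nat (e * n)" "i - nat (e * n)"], of "e * n"] that by simp
    from val_ge_diff[OF this[OF ij(1)] this[OF ij(2)]] show "val_ge vK n (t i - t j)"
      by (simp add: val_ge_K K_closed tK)
  qed
  ultimately obtain x where x: "x \<in> K" and lim: "\<And>n. \<exists>N. \<forall>i\<ge>N. val_ge vK n (t i - x)"
    using complete unfolding valuation_complete_def by blast
  have "val_ge v n (x ^ p - x - \<alpha>)" if "n \<ge> 0" for n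
  proof -
    obtain N where N: "\<And>i. i \<ge> N \<Longrightarrow> val_ge vK n (t i - x)"
      using lim by blast
    have "1 * n \<le> e * n"
      using that e_pos by (intro mult_right_mono) auto
    then have close: "val_ge v n (t i - x)" if "i \<ge> N" for i
      using N[OF that] x tK val_ge_mono[of v "e * n" "t i - x" n] by (simp add: val_ge_K K_closed)
    have "1 * n \<le> int p * n"
      using \<open>n \<ge> 0\<close> p_gt_1 by (intro mult_right_mono) auto
    then have "val_ge v n ((t N - x) ^ p)"
      using val_ge_mono[OF val_ge_power[OF close[OF order_refl], of p], of n] by simp
    moreover have eq: "x ^ p - x - \<alpha> = (t (Suc N) - x) - (t N - x) ^ p"
      by (simp add: t frobenius_diff)
    ultimately show ?thesis
      unfolding eq by (intro val_ge_diff close) simp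
  qed
  from this[of "\<bar>v (x ^ p - x - \<alpha>)\<bar> + 1"] have "x ^ p - x - \<alpha> = 0"
    by (auto simp: val_ge_def)
  then show ?thesis
    using x by auto
qed

text \<open>
  A solution modulo the maximal ideal leaves an error that \<open>artin_schreier_small\<close> absorbs.
\<close>

lemma artin_schreier_integral:
  assumes \<alpha>: "\<alpha> \<in> K" "val_ge v 0 \<alpha>"
  shows "\<exists>\<beta>\<in>K. \<beta> ^ p - \<beta> = \<alpha>"
proof -
  obtain x where x: "x \<in> K" "val_ge v e (x ^ p + (- 1) * x + (- \<alpha>))"
    using residue_trinomial_root[of "- 1" "- \<alpha>"] \<alpha> K_closed(2,7) val_ge_minus[of 0 1] val_ge_minus[of 0 \<alpha>] by auto
  have "- (x ^ p + (- 1) * x + (- \<alpha>)) \<in> K" "val_ge v 1 (- (x ^ p + (- 1) * x + (- \<alpha>)))"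
    by (intro K_closed x(1) \<alpha>(1), rule val_ge_mono[OF val_ge_minus[OF x(2)] e_ge_1])
  from artin_schreier_small[OF this] obtain y where y: "y \<in> K" "y ^ p - y = - (x ^ p + (- 1) * x + (- \<alpha>))"
    by blast
  have "(x + y) ^ p - (x + y) = (x ^ p - x) + (y ^ p - y)"
    by (simp add: frobenius_add)
  also have "\<dots> = \<alpha>"
    using y by simp
  finally show ?thesis
    using K_closed(3)[OF x(1) y(1)] by blast
qed

text \<open>
  A pole of order \<open>p l\<close> has the leading term of a \<open>p\<close>-th power \<open>c\<^sup>p\<close>, and replacing \<open>c\<^sup>p\<close> by \<open>c\<close> lowers the order.
  If this process reaches an integral element, \<open>\<alpha>\<close> is equivalent to \<open>0\<close>, hence also to any uniformizer,
  whose valuation \<open>1\<close> is coprime to \<open>p\<close>.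
\<close>

lemma artin_schreier_reduce:
  assumes "\<alpha> \<in> K"
  shows "\<exists>b\<in>K. \<alpha> + b ^ p - b \<noteq> 0 \<and> coprime (vK (\<alpha> + b ^ p - b)) (int p)"
proof -
  have "\<exists>b\<in>K. \<alpha> + b ^ p - b \<noteq> 0 \<and> coprime (vK (\<alpha> + b ^ p - b)) (int p)"
    if "\<alpha> \<in> K" "val_ge v (- (e * int k)) \<alpha>" for k \<alpha>
    using that
  proof (induction k arbitrary: \<alpha>)
    case 0
    \<comment> \<open>An integral \<open>\<alpha>\<close> is moved to a uniformizer \<open>\<pi>\<close> of \<open>K\<close>.\<close>
    obtain \<pi> where \<pi>: "\<pi> \<in> K" "has_val v (e * 1) \<pi>"
      using exists_has_val_K by blast
    have "val_ge v 0 (\<pi> - \<alpha>)"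
      using 0 has_val_imp_val_ge[OF \<pi>(2), of 0] e_pos by (simp add: val_ge_diff)
    then obtain b where b: "b \<in> K" "b ^ p - b = \<pi> - \<alpha>"
      using artin_schreier_integral[of "\<pi> - \<alpha>"] K_closed(4)[OF \<pi>(1) 0(1)] by blast
    then have "\<alpha> + b ^ p - b = \<pi>"
      by (simp add: algebra_simps)
    moreover have "vK \<pi> = 1" "\<pi> \<noteq> 0"
      using \<pi> has_val_K[OF \<pi>(1), of 1] by (auto simp: has_val_def)
    ultimately show ?case
      using b(1) by auto
  next
    case (Suc k)
    show ?case
    proof (cases "val_ge v (- (e * int k)) \<alpha>")
      case True
      then show ?thesis using Suc by blast
    next
      case False
      have \<alpha>: "has_val v (e * - int (Suc k)) \<alpha>"
      proof (rule ccontr)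
        assume "\<not> ?thesis"
        then have "val_ge v (e * - int (Suc k) + 1) \<alpha>"
          using has_val_or_val_ge_Suc[of v "e * - int (Suc k)" \<alpha>] Suc.prems(2)
          by (simp only: mult_minus_right simp_thms)
        from val_ge_K_Suc[OF Suc.prems(1) this] show False
          using False by (simp add: algebra_simps)
      qed
      then have vK: "vK \<alpha> = - int (Suc k)" "\<alpha> \<noteq> 0"
        using has_val_K[OF Suc.prems(1), of "- int (Suc k)"] by (simp_all only: has_val_def simp_thms)
      show ?thesis
      proof (cases "p dvd Suc k")
        case False
        then have "coprime (Suc k) p"
          using p by (simp add: prime_imp_coprime coprime_commute)
        then have "coprime (vK \<alpha>) (int p)"
          unfolding vK by (simp only: coprime_minus_left_iff coprime_int_iff)
        then show ?thesis
          using vK p_gt_1 by (intro bexI[of _ 0] K_closed) (simp add: zero_power)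
      next
        case True
        then obtain l where l: "Suc k = p * l" by blast
        have "has_val v (e * (int p * - int l)) \<alpha>"
          using \<alpha> unfolding l by (simp add: mult_ac)
        then obtain c where c: "c \<in> K" "has_val v (e * - int l) c"
          "val_ge v (e * (int p * - int l + 1)) (\<alpha> - c ^ p)"
          using pth_power_approximation[OF Suc.prems(1)] by blast
        have "l \<noteq> 0"
          using l by (intro notI) simp
        moreover have "2 * l \<le> p * l"
          using p_gt_1 by (intro mult_le_mono1) simp
        ultimately have "l \<le> k"
          using l by linarith
        then have "- (e * int k) \<le> e * - int l"
          using e_pos by simp
        then have "val_ge v (- (e * int k)) c"
          by (rule has_val_imp_val_ge[OF c(2)])
        moreover have "int p * - int l + 1 = - int k"
          using arg_cong[OF l, of int] by simp
        then have "val_ge v (- (e * int k)) (\<alpha> - c ^ p)"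
          using c(3) by simp
        ultimately have "val_ge v (- (e * int k)) (\<alpha> - c ^ p + c)"
          by (simp add: val_ge_add)
        then obtain b where b: "b \<in> K" "(\<alpha> - c ^ p + c) + b ^ p - b \<noteq> 0"
          "coprime (vK ((\<alpha> - c ^ p + c) + b ^ p - b)) (int p)"
          using Suc.IH[of "\<alpha> - c ^ p + c"] Suc.prems(1) c(1) by (auto simp: K_closed)
        have eq: "(\<alpha> - c ^ p + c) + b ^ p - b = \<alpha> + (b - c) ^ p - (b - c)"
          by (simp add: frobenius_diff)
        then show ?thesis
          using b(2,3) K_closed(4)[OF b(1) c(1)] unfolding eq by blast
      qed
    qed
  qed
  moreover have "val_ge v (- (e * int (nat \<bar>v \<alpha>\<bar>))) \<alpha>"
  proof -
    have "1 * \<bar>v \<alpha>\<bar> \<le> e * \<bar>v \<alpha>\<bar>"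
      using e_pos by (intro mult_right_mono) auto
    then show ?thesis by (auto simp: val_ge_def)
  qed
  ultimately show ?thesis
    using assms by blast
qed

end

section \<open>Approximating the second component by \<open>p\<close>-th powers\<close>

text \<open>
  The first component \<open>a0\<close> of a generator, with \<open>\<sigma>\<close> chosen such that \<open>\<sigma> a0 = a0 + 1\<close>, and the pole
  order \<open>n0\<close> of its image \<open>\<alpha>0\<close> in \<open>K\<close>.
\<close>

locale ramified_witt_generator = ramified_cyclic_p_squared K p \<sigma> v vK
  for K :: "'a::field set" and p :: nat and \<sigma> :: "'a \<Rightarrow> 'a" and v :: "'a \<Rightarrow> int" and vK :: "'a \<Rightarrow> int" +
  fixes a0 :: 'a and n0 :: int
  assumes a0: "\<sigma> a0 = a0 + 1" and \<alpha>0_K: "a0 ^ p - a0 \<in> K"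
    and \<alpha>0_val: "has_val v (- e * n0) (a0 ^ p - a0)" and n0_pos: "n0 > 0" and n0_coprime: "coprime n0 (int p)"
begin

abbreviation \<alpha>0 :: 'a where "\<alpha>0 \<equiv> a0 ^ p - a0"

lemma a0_val: "has_val v (- int p * n0) a0"
proof -
  have neg: "- e * n0 < 0"
    using e_pos n0_pos by simp
  have "has_val v (v a0) a0" "int p * v a0 = int p * (- int p * n0)"
    using has_val_artin_schreier_root[OF \<alpha>0_val neg p_gt_1] by (simp_all add: e_eq mult.assoc)
  moreover have "v a0 = - int p * n0"
    using \<open>int p * v a0 = _\<close> p_gt_1 by (subst (asm) mult_left_cancel) auto
  ultimately show ?thesis
    by simp
qed

lemma of_nat_unit: "0 < m \<Longrightarrow> m < p \<Longrightarrow> has_val v 0 (of_nat m)"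
  using of_nat_power_char[OF p char, of m] p_gt_1
  by (intro has_val_self_power[of _ p]) (auto simp: of_nat_eq_0_iff_char_dvd char dest: dvd_imp_le)

context
  fixes c :: 'a and l :: int and m :: nat and n :: int
  assumes c: "c \<in> K" "has_val v (e * l) c" and m: "m < p" and n: "int p * l - int m * n0 = - n"
begin

lemma monomial_fixed: "(\<sigma> ^^ p) (c * a0 ^ m) = c * a0 ^ m"
  by (simp add: \<sigma>_pow_simps \<sigma>_pow_fixed c \<sigma>_pow_a0[OF a0])

lemma monomial_val: "has_val v (- int p * n) (c * a0 ^ m)"
proof -
  have "e * l + int m * (- int p * n0) = int p * (int p * l - int m * n0)"
    by (simp add: e_eq algebra_simps)
  then have "e * l + int m * (- int p * n0) = - int p * n"
    unfolding n by simp
  then show ?thesis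
    using has_val_mult[OF c(2) has_val_power[OF a0_val, of m]] by simp
qed

text \<open>
  Since \<open>\<sigma>\<close> adds \<open>1\<close> to \<open>a0\<close>, a change of \<open>a0\<^sup>m\<close> replaces one factor \<open>a0\<close> by \<open>1\<close>, which raises the valuation
  by \<open>p n0\<close>.
\<close>

lemma monomial_shift:
  assumes "m > 0"
  shows "has_val v (int p * n0 - int p * n) (\<sigma> (c * a0 ^ m) - c * a0 ^ m)"
proof -
  have "\<sigma> (c * a0 ^ m) - c * a0 ^ m = c * ((a0 + 1) ^ m - a0 ^ m)"
    using c(1) by (simp add: \<sigma>_simps a0 algebra_simps flip: fixed_iff)
  moreover have "- int p * n0 < 0"
    using n0_pos p_gt_1 by simp
  from has_val_power_add_diff[OF a0_val has_val_1 this of_nat_unit[OF assms m]]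
  have "has_val v (e * l + ((int m - 1) * (- int p * n0) + 0)) (c * ((a0 + 1) ^ m - a0 ^ m))"
    by (rule has_val_mult[OF c(2)])
  moreover have "e * l + ((int m - 1) * (- int p * n0) + 0) = int p * (int p * l - int m * n0) + int p * n0"
    by (simp add: e_eq algebra_simps)
  ultimately show ?thesis
    unfolding n by simp
qed

text \<open>
  In the expansion of \<open>\<alpha>0\<^sup>m = (a0\<^sup>p - a0)\<^sup>m\<close> the first deviation from the \<open>p\<close>-th power \<open>a0\<^sup>p\<^sup>m\<close> replaces one
  factor \<open>a0\<^sup>p\<close> by \<open>a0\<close>, which raises the valuation by \<open>p (p - 1) n0\<close>.
\<close>

lemma monomial_pth_power:
  assumes "m > 0"
  shows "has_val v (int p * (int p - 1) * n0 - e * n) (c ^ p * \<alpha>0 ^ m - (c * a0 ^ m) ^ p)"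
proof -
  have "c ^ p * \<alpha>0 ^ m - (c * a0 ^ m) ^ p = c ^ p * ((a0 ^ p + (- a0)) ^ m - (a0 ^ p) ^ m)"
    by (simp add: power_mult_distrib right_diff_distrib mult.commute[of m] flip: power_mult)
  moreover have less: "int p * (- int p * n0) < - int p * n0"
    using n0_pos p_gt_1 by simp
  from has_val_power_add_diff[OF has_val_power[OF a0_val] has_val_minus[OF a0_val] less of_nat_unit[OF assms m]]
  have "has_val v (int p * (e * l) + ((int m - 1) * (int p * (- int p * n0)) + - int p * n0))
     (c ^ p * ((a0 ^ p + (- a0)) ^ m - (a0 ^ p) ^ m))"
    by (rule has_val_mult[OF has_val_power[OF c(2)]])
  moreover have "int p * (e * l) + ((int m - 1) * (int p * (- int p * n0)) + - int p * n0)
     = e * (int p * l - int m * n0) + int p * (int p - 1) * n0"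
    by (simp add: e_eq algebra_simps)
  ultimately show ?thesis
    unfolding n by simp
qed

end

text \<open>
  The leading terms \<open>c\<^sup>p \<alpha>0\<^sup>m\<close> of \<open>\<alpha>\<close> are split off one after the other, and each is replaced by the \<open>p\<close>-th
  power of \<open>c a0\<^sup>m\<close>. The number \<open>k\<close> of steps bounds the part of \<open>\<alpha>\<close> that is not yet treated; once it
  is large, only the error of these replacements remains.
\<close>

lemma pth_power_in_subextension:
  assumes "\<alpha> \<in> K" "val_ge v (- e * n) \<alpha>"
  shows "\<exists>b. (\<sigma> ^^ p) b = b \<and> val_ge v (- int p * n) b \<and> val_ge v (int p * n0 - int p * n) (\<sigma> b - b)
    \<and> val_ge v (min (e * int k - e * n) (int p * (int p - 1) * n0 - e * n)) (\<alpha> - b ^ p)"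
  using assms
proof (induction k arbitrary: \<alpha> n)
  case 0
  have "(\<sigma> ^^ p) 0 = 0 \<and> \<sigma> 0 - 0 = 0"
    by (simp add: \<sigma>_pow_simps \<sigma>_simps)
  then show ?case
    using 0 p_gt_1 by (intro exI[of _ 0]) (auto intro: val_ge_mono simp: zero_power)
next
  case (Suc k)
  let ?B = "int p * (int p - 1) * n0 - e * n"
  show ?case
  proof (cases "has_val v (- e * n) \<alpha>")
    case False
    then have "val_ge v (e * - n + 1) \<alpha>"
      using has_val_or_val_ge_Suc[OF Suc.prems(2)] by simp
    from val_ge_K_Suc[OF Suc.prems(1) this] have "val_ge v (- e * (n - 1)) \<alpha>"
      by (simp add: algebra_simps)
    from Suc.IH[OF Suc.prems(1) this] obtain b where
      b: "(\<sigma> ^^ p) b = b" "val_ge v (- int p * (n - 1)) b" "val_ge v (int p * n0 - int p * (n - 1)) (\<sigma> b - b)"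
      "val_ge v (min (e * int k - e * (n - 1)) (int p * (int p - 1) * n0 - e * (n - 1))) (\<alpha> - b ^ p)"
      by blast
    show ?thesis
    proof (intro exI conjI)
      show "(\<sigma> ^^ p) b = b" by (rule b(1))
      show "val_ge v (- int p * n) b"
        by (rule val_ge_mono[OF b(2)]) (simp add: algebra_simps)
      show "val_ge v (int p * n0 - int p * n) (\<sigma> b - b)"
        by (rule val_ge_mono[OF b(3)]) (simp add: algebra_simps)
      show "val_ge v (min (e * int (Suc k) - e * n) ?B) (\<alpha> - b ^ p)"
        by (rule val_ge_mono[OF b(4)]) (use e_pos in \<open>simp add: algebra_simps min_def\<close>)
    qed
  next
    case True
    obtain c l m where clm: "c \<in> K" "has_val v (e * l) c" "m < p" "int p * l - int m * n0 = - n"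
      and rest: "val_ge v (- e * n + e) (\<alpha> - c ^ p * \<alpha>0 ^ m)"
      using leading_term[OF Suc.prems(1) True \<alpha>0_K \<alpha>0_val n0_coprime] by blast
    let ?x = "c * a0 ^ m"
    have "\<alpha> - c ^ p * \<alpha>0 ^ m \<in> K"
      by (intro K_closed Suc.prems clm \<alpha>0_K)
    moreover have "val_ge v (- e * (n - 1)) (\<alpha> - c ^ p * \<alpha>0 ^ m)"
      using rest by (simp add: algebra_simps)
    ultimately obtain b where
      b: "(\<sigma> ^^ p) b = b" "val_ge v (- int p * (n - 1)) b" "val_ge v (int p * n0 - int p * (n - 1)) (\<sigma> b - b)"
      "val_ge v (min (e * int k - e * (n - 1)) (int p * (int p - 1) * n0 - e * (n - 1))) (\<alpha> - c ^ p * \<alpha>0 ^ m - b ^ p)"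
      using Suc.IH by blast
    have shift: "val_ge v (int p * n0 - int p * n) (\<sigma> ?x - ?x)"
      using clm(1) has_val_imp_val_ge[OF monomial_shift[OF clm]]
      by (cases "m = 0") (auto simp: \<sigma>_simps simp flip: fixed_iff)
    have pth: "val_ge v ?B (c ^ p * \<alpha>0 ^ m - ?x ^ p)"
      using has_val_imp_val_ge[OF monomial_pth_power[OF clm]] by (cases "m = 0") auto
    show ?thesis
    proof (intro exI conjI)
      show "(\<sigma> ^^ p) (?x + b) = ?x + b"
        by (simp add: \<sigma>_pow_simps(3) b(1) monomial_fixed[OF clm])
      show "val_ge v (- int p * n) (?x + b)"
        by (intro val_ge_add has_val_imp_val_ge[OF monomial_val[OF clm]] val_ge_mono[OF b(2)]) (simp_all add: algebra_simps)
      have "\<sigma> (?x + b) - (?x + b) = (\<sigma> ?x - ?x) + (\<sigma> b - b)"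
        by (simp add: \<sigma>_simps(3))
      then show "val_ge v (int p * n0 - int p * n) (\<sigma> (?x + b) - (?x + b))"
        using val_ge_add[OF shift val_ge_mono[OF b(3)]] by (simp add: algebra_simps)
      have eq: "\<alpha> - (?x + b) ^ p = (c ^ p * \<alpha>0 ^ m - ?x ^ p) + (\<alpha> - c ^ p * \<alpha>0 ^ m - b ^ p)"
        by (simp add: frobenius_add)
      have A: "val_ge v (min (e * int (Suc k) - e * n) ?B) (\<alpha> - c ^ p * \<alpha>0 ^ m - b ^ p)"
        by (rule val_ge_mono[OF b(4)]) (use e_pos in \<open>simp add: algebra_simps min_def\<close>)
      have B: "val_ge v (min (e * int (Suc k) - e * n) ?B) (c ^ p * \<alpha>0 ^ m - ?x ^ p)"
        by (rule val_ge_mono[OF pth]) simp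
      show "val_ge v (min (e * int (Suc k) - e * n) ?B) (\<alpha> - (?x + b) ^ p)"
        unfolding eq by (rule val_ge_add[OF B A])
    qed
  qed
qed

text \<open>
  If \<open>n\<close> is coprime to \<open>p\<close>, the leading term \<open>c\<^sup>p \<alpha>0\<^sup>m\<close> has \<open>m > 0\<close> and contributes an error of known
  valuation, which dominates the errors of the later terms.
\<close>

lemma pth_power_approximation_by_subextension:
  assumes \<alpha>: "\<alpha> \<in> K" "has_val v (- e * n) \<alpha>" and n: "coprime n (int p)"
  obtains b where "(\<sigma> ^^ p) b = b" "val_ge v (- int p * n) b"
    "has_val v (int p * n0 - int p * n) (\<sigma> b - b)"
    "has_val v (int p * (int p - 1) * n0 - e * n) (\<alpha> - b ^ p)"
proof -
  obtain c l m where clm: "c \<in> K" "has_val v (e * l) c" "m < p" "int p * l - int m * n0 = - n"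
    and rest: "val_ge v (- e * n + e) (\<alpha> - c ^ p * \<alpha>0 ^ m)"
    using leading_term[OF \<alpha> \<alpha>0_K \<alpha>0_val n0_coprime] by blast
  have "m > 0"
  proof (rule ccontr)
    assume "\<not> m > 0"
    then have "n = int p * - l" using clm(4) by simp
    then have "int p dvd n" by (rule dvdI)
    then have "is_unit (int p)"
      by (rule coprime_common_divisor[OF n _ dvd_refl])
    then show False using p_gt_1 by simp
  qed
  let ?x = "c * a0 ^ m" and ?B = "int p * (int p - 1) * n0 - e * n"
  have "\<alpha> - c ^ p * \<alpha>0 ^ m \<in> K"
    by (intro K_closed \<alpha> clm \<alpha>0_K)
  moreover have "val_ge v (- e * (n - 1)) (\<alpha> - c ^ p * \<alpha>0 ^ m)"
    using rest by (simp add: algebra_simps)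
  ultimately obtain b where
    b: "(\<sigma> ^^ p) b = b" "val_ge v (- int p * (n - 1)) b" "val_ge v (int p * n0 - int p * (n - 1)) (\<sigma> b - b)"
    "val_ge v (min (e * int (nat ((int p - 1) * n0)) - e * (n - 1)) (int p * (int p - 1) * n0 - e * (n - 1))) (\<alpha> - c ^ p * \<alpha>0 ^ m - b ^ p)"
    using pth_power_in_subextension[of "\<alpha> - c ^ p * \<alpha>0 ^ m" "n - 1" "nat ((int p - 1) * n0)"] by blast
  \<comment> \<open>The number of steps is chosen such that \<open>e * k\<close> is at least \<open>p * (p - 1) * n0\<close>.\<close>
  have pos: "(int p - 1) * n0 \<ge> 0"
    using n0_pos p_gt_1 by simp
  have nat: "int (nat ((int p - 1) * n0)) = (int p - 1) * n0"
    using pos by simp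
  have "int p * 1 * ((int p - 1) * n0) \<le> e * ((int p - 1) * n0)"
    unfolding e_eq using p_gt_1 by (intro mult_right_mono mult_left_mono pos) simp_all
  then have "int p * (int p - 1) * n0 \<le> e * ((int p - 1) * n0)"
    by (simp add: mult.assoc)
  moreover have "e * (n - 1) = e * n - e"
    by (simp add: right_diff_distrib)
  ultimately have bound: "?B + 1 \<le> min (e * int (nat ((int p - 1) * n0)) - e * (n - 1)) (int p * (int p - 1) * n0 - e * (n - 1))"
    unfolding nat min.bounded_iff using e_ge_1 by linarith
  show ?thesis
  proof (rule that[of "?x + b"])
    show "(\<sigma> ^^ p) (?x + b) = ?x + b"
      by (simp add: \<sigma>_pow_simps(3) b(1) monomial_fixed[OF clm])
    show "val_ge v (- int p * n) (?x + b)"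
      by (intro val_ge_add has_val_imp_val_ge[OF monomial_val[OF clm]] val_ge_mono[OF b(2)]) (simp_all add: algebra_simps)
    have eq1: "\<sigma> (?x + b) - (?x + b) = (\<sigma> ?x - ?x) + (\<sigma> b - b)"
      by (simp add: \<sigma>_simps(3))
    have eq2: "\<alpha> - (?x + b) ^ p = (c ^ p * \<alpha>0 ^ m - ?x ^ p) + (\<alpha> - c ^ p * \<alpha>0 ^ m - b ^ p)"
      by (simp add: frobenius_add)
    show "has_val v (int p * n0 - int p * n) (\<sigma> (?x + b) - (?x + b))"
      unfolding eq1
      by (intro has_val_add monomial_shift[OF clm \<open>m > 0\<close>] val_ge_mono[OF b(3)]) (use p_gt_1 in \<open>simp add: algebra_simps\<close>)
    have "has_val v ?B ((c ^ p * \<alpha>0 ^ m - ?x ^ p) + (\<alpha> - c ^ p * \<alpha>0 ^ m - b ^ p))"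
      by (intro has_val_add monomial_pth_power[OF clm \<open>m > 0\<close>] val_ge_mono[OF b(4) bound])
    then show "has_val v ?B (\<alpha> - (?x + b) ^ p)"
      unfolding eq2 .
  qed
qed

text \<open>
  By the transition from upper to lower numbering this is \<open>n0 + p (u - n0)\<close>, where
  \<open>u = max (p n0) n1\<close> is the second upper jump.
\<close>

definition second_jump :: "int \<Rightarrow> int" where
  "second_jump n1 = (if n1 \<le> n0 * int p then n0 * (int p ^ 2 - int p + 1) else int p * (n1 - n0) + n0)"

lemma second_jump_gt: "n0 < second_jump n1"
proof -
  have P: "int p \<ge> 2" using p_gt_1 by simp
  show ?thesis
  proof (cases "n1 \<le> n0 * int p")
    case True
    have "0 < n0 * ((int p - 1) * int p)"
      using P n0_pos by simp
    then show ?thesis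
      using True by (simp add: second_jump_def algebra_simps power2_eq_square)
  next
    case False
    have "n0 * 1 \<le> n0 * int p"
      using P n0_pos by (intro mult_left_mono) auto
    then have "0 < int p * (n1 - n0)"
      using False P by simp
    then show ?thesis
      using False by (simp add: second_jump_def)
  qed
qed

text \<open>
  The element is \<open>y = a1 - b\<close>, where \<open>b\<close> is the element of \<open>K(a0)\<close> whose \<open>p\<close>-th power approximates \<open>\<alpha>1\<close>.
  In \<open>y\<^sup>p - y = (\<alpha>1 - b\<^sup>p) + b + C(\<alpha>0, a0)\<close> and \<open>\<sigma> y - y = C(a0, 1) + s - (\<sigma> b - b)\<close>, with \<open>C\<close> the Witt
  carry, the carry dominates if \<open>n1 < p n0\<close>, and the terms \<open>\<alpha>1 - b\<^sup>p\<close> and \<open>\<sigma> b - b\<close> dominate if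
  \<open>n1 > p n0\<close>.
\<close>

lemma exists_test_element:
  assumes \<alpha>1: "\<alpha>1 \<in> K" "has_val v (- e * n1) \<alpha>1" "coprime n1 (int p)"
    and a1: "a1 ^ p - a1 = \<alpha>1 + witt2_carry p \<alpha>0 a0"
    and s: "s ^ p = s" "\<sigma> a1 = a1 + witt2_carry p a0 1 + s" and \<tau>: "(\<sigma> ^^ p) a1 = a1 + 1"
  shows "\<exists>y. has_val v (- second_jump n1) y \<and> has_val v (n0 - second_jump n1) (\<sigma> y - y) \<and> (\<sigma> ^^ p) y - y = 1"
proof -
  obtain b where b: "(\<sigma> ^^ p) b = b" "val_ge v (- int p * n1) b"
    "has_val v (int p * n0 - int p * n1) (\<sigma> b - b)"
    "has_val v (int p * (int p - 1) * n0 - e * n1) (\<alpha>1 - b ^ p)"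
    using pth_power_approximation_by_subextension[OF \<alpha>1] by blast
  define y where "y = a1 - b"
  have p2: "2 \<le> int p" using p_gt_1 by simp
  \<comment> \<open>Coprimality of \<open>n1\<close> to \<open>p\<close> turns the weak inequality of the case distinction into a strict one.\<close>
  have "n1 \<noteq> n0 * int p"
  proof
    assume "n1 = n0 * int p"
    then have "is_unit (int p)"
      by (intro coprime_common_divisor[OF \<alpha>1(3) _ dvd_refl]) simp
    then show False using p_gt_1 by simp
  qed
  have cases: "(n1 + 1 \<le> n0 * int p \<and> second_jump n1 = n0 * (int p ^ 2 - int p + 1)) \<or>
     (n0 * int p + 1 \<le> n1 \<and> second_jump n1 = int p * (n1 - n0) + n0)"
  proof (cases "n1 \<le> n0 * int p")
    case True
    then have "n1 + 1 \<le> n0 * int p" using \<open>n1 \<noteq> n0 * int p\<close> by linarith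
    with True show ?thesis by (simp only: second_jump_def if_True simp_thms)
  next
    case False
    then have "n0 * int p + 1 \<le> n1" by linarith
    with False show ?thesis by (simp only: second_jump_def if_False simp_thms)
  qed
  have carry0: "has_val v (- int p * (n0 * (int p ^ 2 - int p + 1))) (witt2_carry p \<alpha>0 a0)"
  proof -
    have "- e * n0 < - int p * n0"
      using p_gt_1 n0_pos by (simp add: e_eq)
    from has_val_witt2_carry[OF p \<alpha>0_val a0_val this] show ?thesis
      by (simp add: e_eq algebra_simps power2_eq_square)
  qed
  have carry1: "has_val v (- int p * (int p - 1) * n0) (witt2_carry p a0 1)"
  proof -
    have "- int p * n0 < 0"
      using p_gt_1 n0_pos by simp
    from has_val_witt2_carry[OF p a0_val has_val_1 this] show ?thesis
      by (simp add: algebra_simps)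
  qed
  have s0: "val_ge v 0 s"
    using has_val_self_power[OF s(1)] p_gt_1 has_val_imp_val_ge by (cases "s = 0") fastforce+
  have root: "y ^ p - y = (\<alpha>1 - b ^ p) + b + witt2_carry p \<alpha>0 a0"
    using a1 by (simp add: y_def frobenius_diff algebra_simps)
  have shift: "\<sigma> y - y = witt2_carry p a0 1 + s - (\<sigma> b - b)"
    by (simp add: y_def \<sigma>_simps s(2))
  let ?P = "int p"
  have P2: "2 \<le> ?P" using p_gt_1 by simp
  have pos: "1 \<le> i * j" if "1 \<le> i" "1 \<le> j" for i j :: int
    using mult_mono[OF that] that by simp
  have "has_val v (- int p * second_jump n1) (y ^ p - y) \<and> has_val v (n0 - second_jump n1) (\<sigma> y - y)"
    using cases
  proof (elim disjE conjE)
    assume n1: "n1 + 1 \<le> n0 * int p" and L: "second_jump n1 = n0 * (int p ^ 2 - int p + 1)"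
    have gap: "1 \<le> ?P * (?P * n0 - n1)" "1 \<le> ?P * (?P * (?P * n0 - n1))"
      using n1 P2 by (intro pos; simp add: mult.commute)+
    have "0 \<le> n0 * (?P - 1) ^ 2"
      using n0_pos by simp
    then have "1 \<le> ?P * (n0 * (?P ^ 2 - ?P + 1) - n1)"
      using n1 P2 by (intro pos) (simp_all add: algebra_simps power2_eq_square)
    then have "val_ge v (- int p * second_jump n1 + 1) b"
      by (intro val_ge_mono[OF b(2)]) (simp add: L algebra_simps)
    moreover have "val_ge v (- int p * second_jump n1 + 1) (\<alpha>1 - b ^ p)"
      using gap by (intro has_val_imp_val_ge[OF b(4)]) (simp add: L e_eq algebra_simps power2_eq_square)
    ultimately have "has_val v (- int p * second_jump n1) ((\<alpha>1 - b ^ p + b) + witt2_carry p \<alpha>0 a0)"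
      using carry0 unfolding L by (intro has_val_add' val_ge_add)
    moreover
    have "1 \<le> ?P * ((?P - 1) * n0)"
      using P2 n0_pos by (intro pos) simp_all
    then have "val_ge v (n0 - second_jump n1 + 1) s"
      by (intro val_ge_mono[OF s0]) (simp add: L algebra_simps power2_eq_square)
    moreover have "val_ge v (n0 - second_jump n1 + 1) (\<sigma> b - b)"
      using gap by (intro has_val_imp_val_ge[OF b(3)]) (simp add: L algebra_simps power2_eq_square)
    moreover have "n0 - second_jump n1 = - int p * (int p - 1) * n0"
      by (simp add: L algebra_simps power2_eq_square)
    ultimately show ?thesis
      using carry1 unfolding root shift by (simp add: has_val_add has_val_diff)
  next
    assume n1: "n0 * int p + 1 \<le> n1" and L: "second_jump n1 = int p * (n1 - n0) + n0"
    have gap: "1 \<le> ?P * (n1 - ?P * n0)" "1 \<le> ?P * (?P * (n1 - ?P * n0))"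
      using n1 P2 by (intro pos; simp add: mult.commute)+
    have "0 \<le> n0 * (?P - 1)"
      using n0_pos P2 by simp
    then have n10: "1 \<le> n1 - n0"
      using n1 by (simp add: algebra_simps)
    then have "1 \<le> ?P * ((?P - 1) * (n1 - n0))" and s1: "1 \<le> ?P * (n1 - n0)"
      using P2 by (intro pos; simp)+
    then have "val_ge v (- int p * second_jump n1 + 1) b"
      by (intro val_ge_mono[OF b(2)]) (simp add: L algebra_simps)
    moreover have "val_ge v (- int p * second_jump n1 + 1) (witt2_carry p \<alpha>0 a0)"
      using gap by (intro has_val_imp_val_ge[OF carry0]) (simp add: L algebra_simps power2_eq_square)
    moreover have "has_val v (- int p * second_jump n1) (\<alpha>1 - b ^ p)"
    proof -
      have "- int p * second_jump n1 = int p * (int p - 1) * n0 - e * n1"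
        by (simp add: L e_eq algebra_simps)
      then show ?thesis using b(4) by simp
    qed
    ultimately have "has_val v (- int p * second_jump n1) ((\<alpha>1 - b ^ p + b) + witt2_carry p \<alpha>0 a0)"
      by (intro has_val_add)
    moreover
    have "val_ge v (n0 - second_jump n1 + 1) s"
      using s1 by (intro val_ge_mono[OF s0]) (simp add: L algebra_simps)
    moreover have "val_ge v (n0 - second_jump n1 + 1) (witt2_carry p a0 1)"
      using gap by (intro has_val_imp_val_ge[OF carry1]) (simp add: L algebra_simps)
    moreover have "n0 - second_jump n1 = int p * n0 - int p * n1"
      by (simp add: L algebra_simps)
    ultimately show ?thesis
      using b(3) unfolding root shift by (simp add: has_val_diff' val_ge_add)
  qed
  then have y_root: "has_val v (- int p * second_jump n1) (y ^ p - y)" and y_shift: "has_val v (n0 - second_jump n1) (\<sigma> y - y)"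
    by blast+
  have "second_jump n1 > 0"
    using second_jump_gt[of n1] n0_pos by linarith
  then have neg: "- int p * second_jump n1 < 0"
    using p_gt_1 by simp
  have "has_val v (v y) y" "int p * v y = int p * (- second_jump n1)"
    using has_val_artin_schreier_root[OF y_root neg p_gt_1] by simp_all
  moreover have "v y = - second_jump n1"
    using \<open>int p * v y = _\<close> p_gt_1 by (subst (asm) mult_left_cancel) auto
  moreover have "(\<sigma> ^^ p) y - y = 1"
    by (simp add: y_def \<sigma>_pow_simps \<tau> b(1))
  ultimately show ?thesis
    using y_shift by auto
qed

end

section \<open>The ramification filtration seen by one element\<close>

lemma lower_ram_antimono: "i \<le> j \<Longrightarrow> lower_ram K v j \<subseteq> lower_ram K v i"
  by (auto simp: lower_ram_def val_ge_def)

text \<open>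
  The filtration is constant on each interval \<open>(i, i + 1]\<close>, so the union over \<open>\<epsilon>\<close> is the group at the next
  integer and no jump lies strictly between integers.
\<close>

lemma lower_jumps_eq:
  "lower_jumps K v = real_of_int ` {i. 0 \<le> i \<and> lower_ram K v i \<noteq> lower_ram K v (i + 1)}"
proof -
  have U: "(\<Union>\<epsilon>\<in>{0<..}. lower_ram_real K v (l + \<epsilon>)) = lower_ram K v (\<lfloor>l\<rfloor> + 1)" for l :: real
  proof (intro equalityI)
    have "\<lfloor>l\<rfloor> + 1 \<le> \<lceil>l + \<epsilon>\<rceil>" if "\<epsilon> > 0" for \<epsilon>
      using that by linarith
    then show "(\<Union>\<epsilon>\<in>{0<..}. lower_ram_real K v (l + \<epsilon>)) \<subseteq> lower_ram K v (\<lfloor>l\<rfloor> + 1)"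
      unfolding lower_ram_real_def by (intro UN_least lower_ram_antimono) simp
    have "real_of_int (\<lfloor>l\<rfloor> + 1) - l \<in> {0<..}"
      by simp
    moreover have "\<lceil>l + (real_of_int (\<lfloor>l\<rfloor> + 1) - l)\<rceil> = \<lfloor>l\<rfloor> + 1"
      by simp
    ultimately show "lower_ram K v (\<lfloor>l\<rfloor> + 1) \<subseteq> (\<Union>\<epsilon>\<in>{0<..}. lower_ram_real K v (l + \<epsilon>))"
      unfolding lower_ram_real_def by (metis UN_upper)
  qed
  show ?thesis
  proof (intro equalityI subsetI)
    fix l assume "l \<in> lower_jumps K v"
    then have l: "0 \<le> l" "lower_ram K v \<lceil>l\<rceil> \<noteq> lower_ram K v (\<lfloor>l\<rfloor> + 1)"
      unfolding lower_jumps_def mem_Collect_eq U unfolding lower_ram_real_def by blast+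
    then have "\<lceil>l\<rceil> = \<lfloor>l\<rfloor>"
      by (metis ceiling_altdef)
    then have "l = real_of_int \<lfloor>l\<rfloor>"
      by (metis ceiling_altdef add.right_neutral add_left_cancel zero_neq_one)
    then show "l \<in> real_of_int ` {i. 0 \<le> i \<and> lower_ram K v i \<noteq> lower_ram K v (i + 1)}"
      using l \<open>\<lceil>l\<rceil> = \<lfloor>l\<rfloor>\<close> by (intro image_eqI[of _ _ "\<lfloor>l\<rfloor>"]) simp_all
  next
    fix l assume "l \<in> real_of_int ` {i. 0 \<le> i \<and> lower_ram K v i \<noteq> lower_ram K v (i + 1)}"
    then obtain i where "l = real_of_int i" "0 \<le> i" "lower_ram K v i \<noteq> lower_ram K v (i + 1)"
      by blast
    then show "l \<in> lower_jumps K v"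
      unfolding lower_jumps_def mem_Collect_eq U unfolding lower_ram_real_def by simp
  qed
qed

text \<open>
  Iterates stay in the valuation ring because \<open>\<tau>\<close> moves integral elements by integral elements.
\<close>

lemma lower_ram_funpow:
  assumes v: "discrete_valuation v" and \<tau>: "\<tau> \<in> lower_ram K v i" and "i \<ge> 0"
  shows "\<tau> ^^ k \<in> lower_ram K v i"
proof -
  interpret discrete_valuation v by (rule v)
  have G: "comm_ring_hom \<tau>" "bij \<tau>" "\<forall>x\<in>K. \<tau> x = x"
    and d: "\<And>x. val_ge v 0 x \<Longrightarrow> val_ge v (i + 1) (\<tau> x - x)"
    using \<tau> by (auto simp: lower_ram_def Gal_iff valuation_ring_def)
  have "(\<tau> ^^ k) x = x" if "x \<in> K" for x
    using G(3) that by (induction k) auto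
  then have "\<tau> ^^ k \<in> Gal K"
    using G by (auto simp: Gal_iff comm_ring_hom_funpow bij_fn)
  moreover have "val_ge v (i + 1) ((\<tau> ^^ k) x - x)" if x: "val_ge v 0 x" for x
  proof (induction k)
    case (Suc k)
    have "val_ge v 0 ((\<tau> ^^ k) x - x)"
      by (rule val_ge_mono[OF Suc]) (use assms in simp)
    from val_ge_add[OF this x] have "val_ge v 0 ((\<tau> ^^ k) x)"
      by simp
    from val_ge_add[OF d[OF this] Suc] show ?case
      by simp
  qed simp
  ultimately show ?thesis
    by (auto simp: lower_ram_def valuation_ring_def)
qed

context discrete_valuation
begin

text \<open>
  Terms of pairwise distinct valuations cannot cancel. With \<open>n\<close> arbitrary this gives linear
  independence, and with \<open>n = 0\<close> it gives integrality of the terms of an integral sum.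
\<close>

lemma val_ge_sum_distinct:
  assumes "finite I" and inj: "inj_on (\<lambda>i. v (f i)) {i \<in> I. f i \<noteq> 0}" and n: "val_ge v n (sum f I)" and "i \<in> I"
  shows "val_ge v n (f i)"
proof (rule ccontr)
  assume i: "\<not> val_ge v n (f i)"
  define J where "J = {i \<in> I. f i \<noteq> 0}"
  have J: "finite J" "i \<in> J"
    using assms i by (auto simp: J_def)
  then obtain j where j: "j \<in> J" and min: "\<And>k. k \<in> J \<Longrightarrow> v (f j) \<le> v (f k)"
    using ex_min_if_finite[of "(\<lambda>i. v (f i)) ` J"] by (metis (no_types, lifting) arg_min_if_finite(1) arg_min_least empty_iff)
  have "sum f I = sum f J"
    unfolding J_def using assms(1) by (intro sum.mono_neutral_right) auto
  also have "\<dots> = f j + sum f (J - {j})"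
    by (rule sum.remove[OF J(1) j])
  finally have "sum f I = f j + sum f (J - {j})" .
  moreover have "val_ge v (v (f j) + 1) (f k)" if "k \<in> J - {j}" for k
  proof -
    have "v (f k) \<noteq> v (f j)"
      using inj that j by (auto simp: inj_on_def J_def)
    then show ?thesis
      using min[of k] that by (auto simp: val_ge_def)
  qed
  then have "val_ge v (v (f j) + 1) (sum f (J - {j}))"
    by (rule val_ge_sum)
  moreover have "has_val v (v (f j)) (f j)"
    using j by (simp add: has_val_def J_def)
  ultimately have "has_val v (v (f j)) (sum f I)"
    by (simp add: has_val_add)
  then have "n \<le> v (f j)"
    using n by (simp add: val_ge_iff_le)
  also have "\<dots> \<le> v (f i)"
    using J(2) by (rule min)
  finally show False
    using i by (simp add: val_ge_def)
qed

text \<open>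
  The condition \<open>v (\<tau> x - x) \<ge> v x + i\<close>, written with the quotient \<open>\<tau> x / x\<close> because this makes it multiplicative
  in \<open>x\<close>.
\<close>

definition moves :: "('a \<Rightarrow> 'a) \<Rightarrow> int \<Rightarrow> 'a \<Rightarrow> bool" where
  "moves \<tau> i x \<longleftrightarrow> x \<noteq> 0 \<and> val_ge v i (\<tau> x / x - 1)"

lemma moves_iff:
  assumes x: "has_val v m x"
  shows "moves \<tau> i x \<longleftrightarrow> val_ge v (m + i) (\<tau> x - x)"
proof -
  have x0: "x \<noteq> 0" using x by (simp add: has_val_def)
  then have eq: "inverse x * (\<tau> x - x) = \<tau> x / x - 1" "x * (\<tau> x / x - 1) = \<tau> x - x"
    by (simp_all add: field_simps)
  have "val_ge v (m + i) (\<tau> x - x)" if "val_ge v i (\<tau> x / x - 1)"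
    using val_ge_mult[OF has_val_imp_val_ge[OF x order_refl] that] unfolding eq .
  moreover have "val_ge v i (\<tau> x / x - 1)" if "val_ge v (m + i) (\<tau> x - x)"
    using val_ge_mult[OF has_val_imp_val_ge[OF has_val_inverse[OF x] order_refl] that] unfolding eq by simp
  ultimately show ?thesis
    using x0 by (auto simp: moves_def)
qed

context
  fixes \<tau> :: "'a \<Rightarrow> 'a" and i :: int
  assumes \<tau>: "comm_ring_hom \<tau>" and i: "i \<ge> 1"
begin

lemma moves_ratio:
  assumes "moves \<tau> i x" shows "has_val v 0 (\<tau> x / x)"
proof -
  have "has_val v 0 (1 + (\<tau> x / x - 1))"
    by (rule has_val_add[OF has_val_1]) (rule val_ge_mono[of v i], use assms i in \<open>auto simp: moves_def\<close>)
  then show ?thesis by simp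
qed

lemma moves_mult:
  assumes x: "moves \<tau> i x" and y: "moves \<tau> i y"
  shows "moves \<tau> i (x * y)"
proof -
  have eq: "\<tau> (x * y) / (x * y) - 1 = (\<tau> y / y) * (\<tau> x / x - 1) + (\<tau> y / y - 1)"
    by (simp add: comm_ring_homD[OF \<tau>] algebra_simps)
  have "val_ge v 0 (\<tau> y / y)"
    by (rule has_val_imp_val_ge[OF moves_ratio[OF y]]) simp
  then have "val_ge v i (\<tau> (x * y) / (x * y) - 1)"
    unfolding eq using x y by (intro val_ge_add val_ge_mult_int) (simp_all only: moves_def)
  then show ?thesis
    using x y by (simp add: moves_def)
qed

lemma moves_inverse:
  assumes x: "moves \<tau> i x" shows "moves \<tau> i (inverse x)"
proof -
  have nz: "x \<noteq> 0" "\<tau> x \<noteq> 0"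
    using x moves_ratio[OF x] by (auto simp: moves_def has_val_def)
  have "\<tau> (inverse x) = inverse (\<tau> x)"
    using comm_ring_hom_divide[OF \<tau>, of 1 x] comm_ring_homD(2)[OF \<tau>] by (simp add: inverse_eq_divide)
  then have eq: "\<tau> (inverse x) / inverse x - 1 = inverse (\<tau> x / x) * - (\<tau> x / x - 1)"
    using nz by (simp add: field_simps)
  have "val_ge v 0 (inverse (\<tau> x / x))"
    by (rule has_val_imp_val_ge[OF has_val_inverse[OF moves_ratio[OF x]]]) simp
  then have "val_ge v i (\<tau> (inverse x) / inverse x - 1)"
    unfolding eq using x by (intro val_ge_mult_int val_ge_minus) (simp_all only: moves_def)
  then show ?thesis
    using nz by (simp add: moves_def)
qed

lemma moves_fixed: "\<tau> c = c \<Longrightarrow> c \<noteq> 0 \<Longrightarrow> moves \<tau> i c"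
  by (simp add: moves_def)

lemma moves_power: "moves \<tau> i x \<Longrightarrow> moves \<tau> i (x ^ k)"
  by (induction k) (auto simp: moves_mult moves_fixed comm_ring_homD[OF \<tau>])

lemma moves_power_int: "moves \<tau> i x \<Longrightarrow> moves \<tau> i (x powi k)"
  by (auto simp: power_int_def moves_power moves_inverse simp flip: power_inverse)

end

end

lemma inverse_mod_nat:
  fixes a n :: nat
  assumes "coprime a n" "n > 1"
  obtains b where "(a * b) mod n = 1"
proof -
  have "a \<noteq> 0"
    using assms by (intro notI) simp
  then obtain b c where "a * b = n * c + gcd a n"
    using bezout_nat by blast
  then show ?thesis
    using assms that[of b] by (simp add: mod_Suc)
qed

locale ramified_galois = ramified_cyclic_p_squared K p \<sigma> v vK
  for K :: "'a::field set" and p :: nat and \<sigma> :: "'a \<Rightarrow> 'a" and v :: "'a \<Rightarrow> int" and vK :: "'a \<Rightarrow> int" +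
  assumes gal: "Gal K = range (\<lambda>k. \<sigma> ^^ k)"
    and degree: "ring.dimension ring_of_type_algebra (p ^ 2) K UNIV"
begin

text \<open>
  The valuations are congruent to \<open>0, \<dots>, p\<^sup>2 - 1\<close> modulo \<open>p\<^sup>2\<close>.
\<close>

lemma distinct_term_valuations:
  assumes \<pi>: "has_val v 1 \<pi>" and c: "\<And>k. k < p ^ 2 \<Longrightarrow> c k \<in> K"
  shows "inj_on (\<lambda>k. v (c k * \<pi> ^ k)) {k \<in> {..<p ^ 2}. c k * \<pi> ^ k \<noteq> 0}"
proof (rule inj_onI)
  have val: "\<exists>n. v (c k * \<pi> ^ k) = e * n + int k" if k: "k < p ^ 2" and nz: "c k * \<pi> ^ k \<noteq> 0" for k
  proof -
    have "c k \<noteq> 0" using nz by auto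
    from has_val_mult[OF has_val_vK[OF c[OF k] this] has_val_power[OF \<pi>, of k]] show ?thesis
      by (auto simp: has_val_def)
  qed
  fix j k
  assume "j \<in> {k \<in> {..<p ^ 2}. c k * \<pi> ^ k \<noteq> 0}" "k \<in> {k \<in> {..<p ^ 2}. c k * \<pi> ^ k \<noteq> 0}"
    and eq: "v (c j * \<pi> ^ j) = v (c k * \<pi> ^ k)"
  then have jk: "j < p ^ 2" "k < p ^ 2" and nz: "c j * \<pi> ^ j \<noteq> 0" "c k * \<pi> ^ k \<noteq> 0"
    by auto
  obtain m n where "e * m + int j = e * n + int k"
    using val[OF jk(1) nz(1)] val[OF jk(2) nz(2)] eq by metis
  then have "(e * m + int j) mod e = (e * n + int k) mod e"
    by simp
  moreover have "int j < e" "int k < e"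
    using jk by (simp_all add: e_def flip: of_nat_power)
  ultimately show "j = k"
    by simp
qed

lemma uniformizer_powers_span:
  assumes \<pi>: "has_val v 1 \<pi>"
  shows "spans_over K (p ^ 2) (\<lambda>k. \<pi> ^ k)"
proof -
  have "c k = 0" if c: "\<And>k. k < p ^ 2 \<Longrightarrow> c k \<in> K" and sum: "(\<Sum>k<p ^ 2. c k * \<pi> ^ k) = 0" and k: "k < p ^ 2" for c k
  proof (rule ccontr)
    assume "c k \<noteq> 0"
    then have "c k * \<pi> ^ k \<noteq> 0"
      using \<pi> by (simp add: has_val_def)
    moreover have "val_ge v (v (c k * \<pi> ^ k) + 1) (c k * \<pi> ^ k)"
      by (rule val_ge_sum_distinct[OF _ distinct_term_valuations[OF \<pi> c]]) (use sum k in auto)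
    ultimately show False
      by (simp add: val_ge_def)
  qed
  then have "linearly_independent_over K (p ^ 2) (\<lambda>k. \<pi> ^ k)"
    unfolding linearly_independent_over_def by blast
  then show ?thesis
    using independent_dimension_imp_spans[OF subfield] degree by blast
qed

lemma exists_uniformizer_monomial:
  assumes y: "has_val v m y" and m: "coprime m (int p)"
  obtains a c where "c \<in> K" "c \<noteq> 0" "has_val v 1 (y powi a * c)"
proof -
  have "coprime m e"
    using m by (simp add: e_def)
  then obtain a b where ab: "a * m + b * e = 1"
    using bezout_int[of m e] by (auto simp: coprime_iff_gcd_eq_1)
  obtain c where c: "c \<in> K" "has_val v (e * b) c"
    using exists_has_val_K by blast
  have "has_val v 1 (y powi a * c)"
    using has_val_mult[OF has_val_power_int[OF y, of a] c(2)] ab by (simp add: mult.commute)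
  then show ?thesis
    using that c by (auto simp: has_val_def)
qed

text \<open>
  The elements moved by at least \<open>i\<close> form a multiplicative group. If \<open>\<tau>\<close> is in the \<open>i\<close>-th group, this
  contains all units and uniformizers, hence \<open>y\<close>. Conversely, it contains \<open>K\<close> without \<open>0\<close>, and together
  with \<open>y\<close> a uniformizer \<open>\<pi>\<close>. An integral element is a sum of integral terms \<open>b\<^sub>k \<pi>\<^sup>k\<close>, of which those with
  \<open>k > 0\<close> have positive valuation and the one with \<open>k = 0\<close> is fixed, so \<open>\<tau>\<close> moves each by \<open>i + 1\<close>.
\<close>

lemma lower_ram_test:
  assumes \<tau>: "\<tau> \<in> Gal K" and y: "has_val v m y" "coprime m (int p)" and i: "i \<ge> 1"
  shows "\<tau> \<in> lower_ram K v i \<longleftrightarrow> val_ge v (m + i) (\<tau> y - y)"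
proof -
  have hom\<tau>: "comm_ring_hom \<tau>" and fix\<tau>: "\<And>x. x \<in> K \<Longrightarrow> \<tau> x = x"
    using \<tau> by (auto simp: Gal_iff)
  have ram: "\<tau> \<in> lower_ram K v i \<longleftrightarrow> (\<forall>x. val_ge v 0 x \<longrightarrow> val_ge v (i + 1) (\<tau> x - x))"
    using \<tau> by (auto simp: lower_ram_def valuation_ring_def)
  have "moves \<tau> i y" if G: "\<tau> \<in> lower_ram K v i"
  proof -
    obtain \<pi> where \<pi>: "has_val v 1 \<pi>"
      using exists_has_val by blast
    have "val_ge v (1 + i) (\<tau> \<pi> - \<pi>)"
      using G ram has_val_imp_val_ge[OF \<pi>, of 0] by (simp add: add.commute)
    then have m\<pi>: "moves \<tau> i \<pi>"
      by (simp add: moves_iff[OF \<pi>])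
    define w where "w = y / \<pi> powi m"
    have w: "has_val v 0 w"
      using has_val_divide[OF y(1) has_val_power_int[OF \<pi>, of m]] by (simp add: w_def)
    have "val_ge v (i + 1) (\<tau> w - w)"
      using G ram has_val_imp_val_ge[OF w, of 0] by simp
    then have "val_ge v (0 + i) (\<tau> w - w)"
      by (rule val_ge_mono) simp
    then have "moves \<tau> i w"
      by (simp add: moves_iff[OF w])
    then have "moves \<tau> i (\<pi> powi m * w)"
      by (intro moves_mult[OF hom\<tau> i] moves_power_int[OF hom\<tau> i] m\<pi>)
    moreover have "\<pi> powi m * w = y"
      using \<pi> by (simp add: w_def has_val_def)
    ultimately show ?thesis by simp
  qed
  moreover have "\<tau> \<in> lower_ram K v i" if mov: "moves \<tau> i y"
  proof -
    obtain a c where c: "c \<in> K" "c \<noteq> 0" and \<pi>: "has_val v 1 (y powi a * c)"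
      using exists_uniformizer_monomial[OF y] by blast
    define \<pi> where "\<pi> = y powi a * c"
    have \<pi>: "has_val v 1 \<pi>" using \<pi> by (simp add: \<pi>_def)
    have m\<pi>: "moves \<tau> i \<pi>"
      unfolding \<pi>_def by (intro moves_mult[OF hom\<tau> i] moves_power_int[OF hom\<tau> i] mov moves_fixed[OF hom\<tau> i] fix\<tau> c)
    have "val_ge v (i + 1) (\<tau> x - x)" if x: "val_ge v 0 x" for x
    proof -
      obtain b where b: "\<And>k. k < p ^ 2 \<Longrightarrow> b k \<in> K" "x = (\<Sum>k<p ^ 2. b k * \<pi> ^ k)"
        using uniformizer_powers_span[OF \<pi>] unfolding spans_over_def by blast
      let ?t = "\<lambda>k. b k * \<pi> ^ k"
      have term_moves: "val_ge v (i + 1) (\<tau> (?t k) - ?t k)" if k: "k < p ^ 2" for k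
      proof (cases "k = 0 \<or> ?t k = 0")
        case True
        then have "\<tau> (?t k) = ?t k"
        proof
          assume "k = 0"
          then show ?thesis using fix\<tau>[OF b(1)[OF k]] by simp
        next
          assume "?t k = 0"
          then show ?thesis using comm_ring_homD(1)[OF hom\<tau>] by (simp only:)
        qed
        then show ?thesis by simp
      next
        case False
        then have nz: "b k \<noteq> 0" "k > 0" by auto
        define n where "n = vK (b k)"
        have n: "has_val v (e * n) (b k)"
          unfolding n_def by (rule has_val_vK[OF b(1)[OF k] nz(1)])
        have t: "has_val v (e * n + int k) (?t k)"
          using has_val_mult[OF n has_val_power[OF \<pi>, of k]] by simp
        have "val_ge v 0 (?t k)"
          by (rule val_ge_sum_distinct[OF _ distinct_term_valuations[OF \<pi> b(1)]]) (use x b(2) k in auto)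
        then have ge0: "0 \<le> e * n + int k"
          using t by (simp add: val_ge_iff_le)
        have "e * n + int k \<noteq> 0"
        proof
          assume "e * n + int k = 0"
          then have "int k = e * - n" by simp
          then have "e dvd int k" by (rule dvdI)
          then have "e \<le> int k" using nz by (intro zdvd_imp_le) auto
          then show False using k by (simp add: e_def flip: of_nat_power)
        qed
        moreover have "moves \<tau> i (?t k)"
          by (intro moves_mult[OF hom\<tau> i] moves_power[OF hom\<tau> i] m\<pi> moves_fixed[OF hom\<tau> i] fix\<tau> b(1) k nz)
        ultimately show ?thesis
          using moves_iff[OF t, of \<tau> i] ge0 val_ge_mono[of v "e * n + int k + i" _ "i + 1"] by simp
      qed
      have "\<tau> x - x = (\<Sum>k<p ^ 2. \<tau> (?t k) - ?t k)"
        unfolding b(2) comm_ring_homD(9)[OF hom\<tau>] by (rule sum_subtractf[symmetric])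
      moreover have "val_ge v (i + 1) \<dots>"
        by (rule val_ge_sum) (use term_moves in auto)
      ultimately show ?thesis by simp
    qed
    then show ?thesis
      using ram by simp
  qed
  ultimately show ?thesis
    using moves_iff[OF y(1)] by blast
qed

lemma \<sigma>_pow_mod: "\<sigma> ^^ k = \<sigma> ^^ (k mod p ^ 2)"
proof -
  have "\<sigma> ^^ k = \<sigma> ^^ (k mod p ^ 2 + p ^ 2 * (k div p ^ 2))"
    by simp
  also have "\<dots> = \<sigma> ^^ (k mod p ^ 2) \<circ> \<sigma> ^^ (p ^ 2 * (k div p ^ 2))"
    by (rule funpow_add)
  also have "\<sigma> ^^ (p ^ 2 * (k div p ^ 2)) = id"
    unfolding order by simp
  finally show ?thesis by simp
qed

text \<open>
  By \<open>lower_ram_test\<close> the \<open>i\<close>-th group contains \<open>\<sigma>\<close> exactly for \<open>i \<le> n\<close> and \<open>\<sigma>\<^sup>p\<close> exactly for \<open>i \<le> l\<close>. A power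
  of \<open>\<sigma>\<close> other than the identity generates the same subgroup as \<open>\<sigma>\<close> or as \<open>\<sigma>\<^sup>p\<close>, so this determines the
  filtration.
\<close>

lemma lower_jumps_from_test_element:
  assumes y: "has_val v (- l) y" "coprime l (int p)"
    and \<sigma>y: "has_val v (n - l) (\<sigma> y - y)" and \<tau>y: "(\<sigma> ^^ p) y - y = 1" and n: "1 \<le> n" "n < l"
  shows "lower_jumps K v = {real_of_int n, real_of_int l}"
proof -
  have p2: "p ^ 2 > 1"
    using one_less_power[OF p_gt_1, of 2] by simp
  have cop: "coprime (- l) (int p)"
    using y(2) by simp
  have gen: "\<sigma> \<in> lower_ram K v i \<longleftrightarrow> i \<le> n" if "i \<ge> 1" for i
  proof -
    have "\<sigma> ^^ 1 \<in> Gal K" unfolding gal by blast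
    then show ?thesis
      using lower_ram_test[OF _ y(1) cop that, of \<sigma>] \<sigma>y by (simp add: val_ge_iff_le)
  qed
  have sub: "\<sigma> ^^ p \<in> lower_ram K v i \<longleftrightarrow> i \<le> l" if "i \<ge> 1" for i
  proof -
    have "\<sigma> ^^ p \<in> Gal K" unfolding gal by blast
    then show ?thesis
      using lower_ram_test[OF _ y(1) cop that, of "\<sigma> ^^ p"] \<tau>y has_val_1 by (simp add: val_ge_iff_le)
  qed
  have mem: "\<sigma> ^^ k \<in> lower_ram K v i \<longleftrightarrow> i \<le> n \<or> (p dvd k \<and> i \<le> l) \<or> p ^ 2 dvd k" if i: "i \<ge> 1" for i k
  proof -
    have pow: "\<tau> ^^ j \<in> lower_ram K v i" if "\<tau> \<in> lower_ram K v i" for \<tau> j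
      by (rule lower_ram_funpow[OF discrete_valuation_axioms that]) (use i in simp)
    consider "\<not> p dvd k" | "p dvd k" "\<not> p ^ 2 dvd k" | "p ^ 2 dvd k" by blast
    then show ?thesis
    proof cases
      case 1
      then have "coprime k (p ^ 2)"
        using prime_imp_coprime[OF p, of k] by (simp add: coprime_commute[of k])
      then obtain j where "(k * j) mod p ^ 2 = 1"
        using p2 by (rule inverse_mod_nat)
      then have "(\<sigma> ^^ k) ^^ j = \<sigma>"
        using \<sigma>_pow_mod[of "k * j"] by (simp add: funpow_mult mult.commute)
      then have "\<sigma> ^^ k \<in> lower_ram K v i \<longleftrightarrow> \<sigma> \<in> lower_ram K v i"
        using pow by metis
      moreover have "\<not> p ^ 2 dvd k"
        using 1 by (auto simp: power2_eq_square dest: dvd_mult_left)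
      ultimately show ?thesis
        using gen[OF i] 1 by blast
    next
      case 2
      then obtain t where t: "k = p * t" by blast
      have "\<not> p dvd t"
        using 2 t by (auto simp: power2_eq_square)
      then have "coprime t (p ^ 2)"
        using prime_imp_coprime[OF p, of t] by (simp add: coprime_commute[of t])
      then obtain j where j: "(t * j) mod p ^ 2 = 1"
        using p2 by (rule inverse_mod_nat)
      have "k * j = p * (t * j)"
        by (simp add: t)
      then have "(k * j) mod p ^ 2 = p mod p ^ 2"
        using j by (metis mod_mult_right_eq mult.right_neutral)
      then have "(\<sigma> ^^ k) ^^ j = \<sigma> ^^ p"
        using \<sigma>_pow_mod[of "k * j"] \<sigma>_pow_mod[of p] by (simp add: funpow_mult mult.commute)
      moreover have "(\<sigma> ^^ p) ^^ t = \<sigma> ^^ k"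
        by (simp add: funpow_mult t mult.commute)
      ultimately have "\<sigma> ^^ k \<in> lower_ram K v i \<longleftrightarrow> \<sigma> ^^ p \<in> lower_ram K v i"
        using pow by metis
      then show ?thesis
        using sub[OF i] 2 n by auto
    next
      case 3
      then have "\<sigma> ^^ k = id"
        by (simp add: order)
      moreover have "id \<in> lower_ram K v i"
        by (auto simp: lower_ram_def Gal_iff comm_ring_hom_def)
      ultimately show ?thesis
        using 3 by simp
    qed
  qed
  have in_Gal: "lower_ram K v i \<subseteq> range (\<lambda>k. \<sigma> ^^ k)" for i
    unfolding gal[symmetric] by (auto simp: lower_ram_def)
  have "lower_ram K v i \<noteq> lower_ram K v (i + 1) \<longleftrightarrow> i = n \<or> i = l" if "i \<ge> 0" for i
  proof (cases "i = 0")
    case True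
    have "range (\<lambda>k. \<sigma> ^^ k) \<subseteq> lower_ram K v 1"
      using mem[of 1] n by auto
    moreover have "lower_ram K v 1 \<subseteq> lower_ram K v 0"
      by (rule lower_ram_antimono) simp
    ultimately have "lower_ram K v 0 = lower_ram K v 1"
      using in_Gal[of 0] by blast
    then show ?thesis
      using True n by simp
  next
    case False
    with that have i: "i \<ge> 1" by simp
    show ?thesis
    proof (cases "i = n \<or> i = l")
      case True
      then show ?thesis
        using gen[OF i] gen[of "i + 1"] sub[OF i] sub[of "i + 1"] i by (elim disjE) auto
    next
      case False
      then have "\<sigma> ^^ k \<in> lower_ram K v i \<longleftrightarrow> \<sigma> ^^ k \<in> lower_ram K v (i + 1)" for k
        using mem[OF i, of k] mem[of "i + 1" k] i by auto
      then have "lower_ram K v i = lower_ram K v (i + 1)"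
        using in_Gal[of i] in_Gal[of "i + 1"] by blast
      then show ?thesis
        using False by simp
    qed
  qed
  then have "0 \<le> i \<and> lower_ram K v i \<noteq> lower_ram K v (i + 1) \<longleftrightarrow> i \<in> {n, l}" for i
    using n by (cases "0 \<le> i") auto
  then have "{i. 0 \<le> i \<and> lower_ram K v i \<noteq> lower_ram K v (i + 1)} = {n, l}"
    by blast
  then show ?thesis
    unfolding lower_jumps_eq by simp
qed

end

section \<open>Reduced generators and their jumps\<close>

text \<open>
  Adding an element of \<open>K\<close> to \<open>a0\<close> or \<open>a1\<close> does not change its increment under \<open>\<sigma>\<close>. The first component
  has to be reduced before \<open>a1\<close> is chosen, because \<open>a1\<close> depends on it.
\<close>

lemma (in ramified_cyclic_p_squared) exists_reduced_generator:
  "\<exists>a0 a1 \<alpha>0 \<alpha>1. reduced_witt2_generator p K vK (a0, a1) (\<alpha>0, \<alpha>1)"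
proof -
  obtain x where x: "\<sigma> x = x + 1"
    using exists_a0 by blast
  then have "x ^ p - x \<in> K"
    by (simp add: \<sigma>_simps frobenius_add flip: fixed_iff)
  then obtain b where b: "b \<in> K" "x ^ p - x + b ^ p - b \<noteq> 0" "coprime (vK (x ^ p - x + b ^ p - b)) (int p)"
    using artin_schreier_reduce by blast
  define a0 where "a0 = x + b"
  have \<alpha>0: "a0 ^ p - a0 = x ^ p - x + b ^ p - b"
    by (simp add: a0_def frobenius_add)
  have \<alpha>0_K: "a0 ^ p - a0 \<in> K"
    unfolding \<alpha>0 by (intro K_closed b \<open>x ^ p - x \<in> K\<close>)
  have a0: "\<sigma> a0 = a0 + 1"
    using x b(1) by (simp add: a0_def \<sigma>_simps flip: fixed_iff)
  obtain y where y: "\<sigma> y = y + witt2_carry p a0 1"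
    using exists_a1[OF a0] by blast
  define \<beta> where "\<beta> = y ^ p - y - witt2_carry p (a0 ^ p - a0) a0"
  have "D \<beta> = 0"
    unfolding \<beta>_def artin_schreier_witt_shift[OF a0 \<alpha>0_K] y using p_gt_1 by (simp add: zero_power)
  then have \<beta>_K: "\<beta> \<in> K"
    by (simp only: D_eq_0_iff)
  then obtain c where c: "c \<in> K" "\<beta> + c ^ p - c \<noteq> 0" "coprime (vK (\<beta> + c ^ p - c)) (int p)"
    using artin_schreier_reduce by blast
  define a1 where "a1 = y + c"
  have \<alpha>1: "a1 ^ p - a1 - witt2_carry p (a0 ^ p - a0) a0 = \<beta> + c ^ p - c"
    by (simp add: a1_def \<beta>_def frobenius_add)
  have "\<sigma> a1 = a1 + witt2_carry p a0 1 + 0"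
    using y c(1) by (simp add: a1_def \<sigma>_simps flip: fixed_iff)
  then have a1: "(\<sigma> ^^ p) a1 = a1 + 1"
    by (rule \<sigma>_pow_p_a1[OF a0]) (rule K_closed)
  have "\<beta> + c ^ p - c \<in> K"
    by (intro K_closed c \<beta>_K)
  then have "reduced_witt2_generator p K vK (a0, a1) (a0 ^ p - a0, \<beta> + c ^ p - c)"
    using b c \<alpha>0_K \<alpha>0 \<alpha>1 monomials_generate[OF a0 a1]
    by (simp add: reduced_witt2_generator_def witt2_diff_eq reduced_witt2_def)
  then show ?thesis by blast
qed

text \<open>
  The increment \<open>\<sigma> a0 - a0\<close> is a nonzero element \<open>j\<close> of the prime field, and \<open>\<rho>\<close> is the power of \<open>\<sigma>\<close> with the
  inverse of \<open>j\<close> modulo \<open>p\<close> as exponent.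
\<close>

lemma (in ramified_galois) normalized_generator:
  assumes a0: "\<sigma> a0 \<noteq> a0" and \<alpha>: "a0 ^ p - a0 \<in> K"
  obtains \<rho> where "ramified_galois K p \<rho> v vK" "\<rho> a0 = a0 + 1"
proof -
  have "\<sigma> (a0 ^ p - a0) = a0 ^ p - a0"
    using \<alpha> by (simp only: fixed_iff)
  then have "(\<sigma> a0 - a0) ^ p = \<sigma> a0 - a0"
    by (simp add: \<sigma>_simps frobenius_diff algebra_simps)
  then obtain j where j: "j < p" "\<sigma> a0 - a0 = of_nat j"
    using prime_field_roots[OF p char] by metis
  then have \<sigma>a0: "\<sigma> a0 = a0 + of_nat j"
    by (simp add: algebra_simps)
  then have "j \<noteq> 0"
    using a0 by (intro notI) simp
  then have "\<not> p dvd j"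
    using j(1) by (auto dest: dvd_imp_le)
  then have "coprime j p"
    using prime_imp_coprime[OF p, of j] by (simp add: coprime_commute)
  then obtain i where i: "(j * i) mod p = 1"
    using p_gt_1 by (rule inverse_mod_nat)
  have "(\<sigma> ^^ k) a0 = a0 + of_nat (j * k)" for k
    by (induction k) (simp_all add: \<sigma>_simps \<sigma>a0 algebra_simps)
  moreover have "(of_nat (j * i) :: 'a) = 1"
  proof -
    have "(of_nat (j * i) :: 'a) = of_nat (p * (j * i div p) + j * i mod p)"
      by simp
    also have "\<dots> = 1"
      unfolding i of_nat_add of_nat_mult[of p] by simp
    finally show ?thesis .
  qed
  ultimately have \<rho>a0: "(\<sigma> ^^ i) a0 = a0 + 1"
    by simp
  have "\<not> p dvd i"
    using i p_gt_1 by (auto simp: mod_eq_0_iff_dvd elim!: dvdE)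
  then have cop: "coprime i (p ^ 2)"
    using prime_imp_coprime[OF p, of i] by (simp add: coprime_commute[of i])
  have ord: "(\<sigma> ^^ i) ^^ k = id \<longleftrightarrow> p ^ 2 dvd k" for k
    using coprime_dvd_mult_right_iff[of "p ^ 2" i k] cop by (simp add: funpow_mult order coprime_commute mult.commute)
  have "p ^ 2 > 1"
    using one_less_power[OF p_gt_1, of 2] by simp
  with cop obtain t where t: "(i * t) mod p ^ 2 = 1"
    by (rule inverse_mod_nat)
  then have \<sigma>t: "(\<sigma> ^^ i) ^^ t = \<sigma>"
    using \<sigma>_pow_mod[of "i * t"] by (simp add: funpow_mult mult.commute)
  have "Gal K = range (\<lambda>k. (\<sigma> ^^ i) ^^ k)"
  proof (intro equalityI subsetI)
    fix \<tau> assume "\<tau> \<in> Gal K"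
    then obtain k where "\<tau> = \<sigma> ^^ k" unfolding gal by blast
    then have "\<tau> = (\<sigma> ^^ i) ^^ (t * k)"
      using \<sigma>t by (metis funpow_mult mult.commute)
    then show "\<tau> \<in> range (\<lambda>k. (\<sigma> ^^ i) ^^ k)" by blast
  next
    fix \<tau> assume "\<tau> \<in> range (\<lambda>k. (\<sigma> ^^ i) ^^ k)"
    then show "\<tau> \<in> Gal K"
      unfolding gal by (auto simp: funpow_mult)
  qed
  moreover have "(\<sigma> ^^ i) x = x \<longleftrightarrow> x \<in> K" for x
  proof
    assume x: "(\<sigma> ^^ i) x = x"
    have "((\<sigma> ^^ i) ^^ k) x = x" for k
      by (induction k) (simp_all add: x)
    then show "x \<in> K"
      using \<sigma>t fixed_iff by metis
  qed (rule \<sigma>_pow_fixed)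
  ultimately have "ramified_galois K p (\<sigma> ^^ i) v vK"
    by (intro ramified_galois.intro ramified_cyclic_p_squared.intro cyclic_p_squared.intro
        ramified_cyclic_p_squared_axioms.intro ramified_galois_axioms.intro discrete_valuation_axioms
        p char comm_ring_hom_funpow[OF hom] ord subfield vK complete alg_closed v_K degree)
  then show ?thesis
    using that \<rho>a0 by blast
qed

text \<open>
  That \<open>\<alpha>0\<close> has a pole is a consequence of the hypothesis that \<open>(a0, a1)\<close> generates \<open>L\<close>: otherwise
  \<open>artin_schreier_integral\<close> would put \<open>a0\<close> into \<open>K\<close>.
\<close>

lemma (in ramified_galois) lower_jumps_reduced_generator:
  assumes gen: "reduced_witt2_generator p K vK (a0, a1) (\<alpha>0, \<alpha>1)"
  defines "n0 \<equiv> - vK \<alpha>0" and "n1 \<equiv> - vK \<alpha>1"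
  shows "lower_jumps K v = (if n1 \<le> n0 * int p
    then {real_of_int n0, real_of_int (n0 * (int p ^ 2 - int p + 1))}
    else {real_of_int n0, real_of_int (int p * (n1 - n0) + n0)})"
proof -
  have \<alpha>0: "\<alpha>0 = a0 ^ p - a0" "\<alpha>0 \<in> K" "\<alpha>0 \<noteq> 0" "coprime (vK \<alpha>0) (int p)"
    and \<alpha>1: "\<alpha>1 = a1 ^ p - a1 - witt2_carry p (a0 ^ p - a0) a0" "\<alpha>1 \<in> K" "\<alpha>1 \<noteq> 0" "coprime (vK \<alpha>1) (int p)"
    and generate: "generate_field ring_of_type_algebra (K \<union> {a0, a1}) = UNIV"
    using gen by (auto simp: reduced_witt2_generator_def witt2_diff_eq reduced_witt2_def)
  have a0_K: "a0 \<notin> K"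
    using generator_moves_a0[OF generate] \<alpha>1 by simp
  have val\<alpha>0: "has_val v (- e * n0) \<alpha>0"
    using has_val_vK[OF \<alpha>0(2,3)] by (simp add: n0_def)
  have val\<alpha>1: "has_val v (- e * n1) \<alpha>1"
    using has_val_vK[OF \<alpha>1(2,3)] by (simp add: n1_def)
  have n0_coprime: "coprime n0 (int p)" and n1_coprime: "coprime n1 (int p)"
    using \<alpha>0(4) \<alpha>1(4) by (simp_all add: n0_def n1_def)
  have n0_pos: "n0 > 0"
  proof (rule ccontr)
    assume "\<not> n0 > 0"
    then have "0 \<le> - e * n0"
      using e_pos by (simp add: mult_nonneg_nonpos)
    then have "val_ge v 0 \<alpha>0"
      by (rule has_val_imp_val_ge[OF val\<alpha>0])
    then obtain \<beta> where \<beta>: "\<beta> \<in> K" "\<beta> ^ p - \<beta> = \<alpha>0"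
      using artin_schreier_integral \<alpha>0(2) by blast
    then have "(a0 - \<beta>) ^ p = a0 - \<beta>"
      using \<alpha>0(1) by (simp add: frobenius_diff algebra_simps)
    then obtain j where "a0 - \<beta> = of_nat j"
      using prime_field_roots[OF p char] by metis
    then have "a0 = \<beta> + of_nat j"
      by (simp add: algebra_simps)
    then show False
      using a0_K \<beta>(1) by (simp add: K_closed)
  qed
  have "\<sigma> a0 \<noteq> a0"
    using a0_K by (simp add: fixed_iff)
  then obtain \<rho> where \<rho>: "ramified_galois K p \<rho> v vK" "\<rho> a0 = a0 + 1"
    using normalized_generator \<alpha>0 by metis
  interpret \<rho>: ramified_galois K p \<rho> v vK by (rule \<rho>(1))
  interpret W: ramified_witt_generator K p \<rho> v vK a0 n0
    by unfold_locales (use \<rho>(2) \<alpha>0 val\<alpha>0 n0_pos n0_coprime in simp_all)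
  define s where "s = \<rho> a1 - a1 - witt2_carry p a0 1"
  have \<rho>a1: "\<rho> a1 = a1 + witt2_carry p a0 1 + s"
    by (simp add: s_def)
  have "\<rho>.D (a1 ^ p - a1 - witt2_carry p (a0 ^ p - a0) a0) = 0"
    using \<alpha>1(1,2) by (simp only: \<rho>.D_eq_0_iff)
  then have s: "s ^ p = s"
    using \<rho>.artin_schreier_witt_shift[OF \<rho>(2) W.\<alpha>0_K, of a1] by (simp add: s_def)
  then obtain j where "s = of_nat j"
    using prime_field_roots[OF p char] by metis
  then have "s \<in> K"
    by (simp add: K_closed)
  then have \<tau>: "(\<rho> ^^ p) a1 = a1 + 1"
    by (rule \<rho>.\<sigma>_pow_p_a1[OF \<rho>(2) \<rho>a1])
  have "a1 ^ p - a1 = \<alpha>1 + witt2_carry p (a0 ^ p - a0) a0"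
    by (simp add: \<alpha>1(1))
  then obtain y where y: "has_val v (- W.second_jump n1) y" "has_val v (n0 - W.second_jump n1) (\<rho> y - y)" "(\<rho> ^^ p) y - y = 1"
    using W.exists_test_element[OF \<alpha>1(2) val\<alpha>1 n1_coprime _ s \<rho>a1 \<tau>] by blast
  have "\<exists>t. n0 = W.second_jump n1 - int p * t"
  proof (cases "n1 \<le> n0 * int p")
    case True
    then show ?thesis
      by (intro exI[of _ "n0 * (int p - 1)"]) (simp add: W.second_jump_def algebra_simps power2_eq_square)
  next
    case False
    then show ?thesis
      by (intro exI[of _ "n1 - n0"]) (simp add: W.second_jump_def)
  qed
  then obtain t where t: "n0 = W.second_jump n1 - int p * t" by blast
  have second_jump: "coprime (W.second_jump n1) (int p)"
  proof (rule coprimeI)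
    fix c assume c: "c dvd W.second_jump n1" "c dvd int p"
    then have "c dvd n0"
      by (subst t) (intro dvd_diff dvd_mult2)
    then show "is_unit c"
      using c(2) by (rule coprime_common_divisor[OF n0_coprime])
  qed
  have "lower_jumps K v = {real_of_int n0, real_of_int (W.second_jump n1)}"
    by (rule \<rho>.lower_jumps_from_test_element[OF y(1) second_jump y(2,3)]) (use n0_pos W.second_jump_gt in simp_all)
  then show ?thesis
    by (simp add: W.second_jump_def)
qed

theorem lemma3p4:
  fixes K :: "'l::field set" and vK vL :: "'l \<Rightarrow> int" and p :: nat
  assumes "p > 0" and "CHAR('l) = p"
    and "local_field K vK"
    and "algebraically_closed (residue_field K vK)"
    and "local_field (UNIV :: 'l set) vL"
    and "galois_extension K"
    and "Gal_group K \<cong> integer_mod_group (p ^ 2)"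
    and "totally_ramified K vK vL"
  shows "(\<exists>a0 a1 \<alpha>0 \<alpha>1. reduced_witt2_generator p K vK (a0, a1) (\<alpha>0, \<alpha>1)) \<and>
    (\<forall>a0 a1 \<alpha>0 \<alpha>1. reduced_witt2_generator p K vK (a0, a1) (\<alpha>0, \<alpha>1) \<longrightarrow>
      (let n0 = - vK \<alpha>0; n1 = - vK \<alpha>1 in
        lower_jumps K vL =
          (if n1 \<le> n0 * int p
           then {real_of_int n0, real_of_int (n0 * (int p ^ 2 - int p + 1))}
           else {real_of_int n0, real_of_int (int p * (n1 - n0) + n0)})))"
proof -
  have p: "Factorial_Ring.prime p"
    using assms(1,2) prime_CHAR_semidom[where 'a = 'l] by simp
  then have "p ^ 2 > 1"
    using one_less_power[OF prime_gt_1_nat, of p 2] by simp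
  with assms(7) obtain \<sigma> where \<sigma>: "\<sigma> \<in> Gal K" "Gal K = range (\<lambda>k. \<sigma> ^^ k)" "\<And>k. \<sigma> ^^ k = id \<longleftrightarrow> p ^ 2 dvd k"
    by (rule cyclic_Gal_generator) blast
  have K: "subfield K ring_of_type_algebra"
    using assms(6) by (simp add: galois_extension_def)
  have hom: "comm_ring_hom \<sigma>"
    using \<sigma>(1) by (simp only: Gal_iff)
  have "\<sigma> x = x \<longleftrightarrow> x \<in> K" for x
  proof
    assume x: "\<sigma> x = x"
    have "(\<sigma> ^^ k) x = x" for k
      by (induction k) (simp_all add: x)
    then have "\<forall>\<tau>\<in>Gal K. \<tau> x = x"
      unfolding \<sigma>(2) by blast
    then show "x \<in> K"
      using assms(6) unfolding galois_extension_def by blast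
  qed (use \<sigma>(1) in \<open>simp add: Gal_iff\<close>)
  then interpret cyclic_p_squared K p \<sigma>
    by unfold_locales (use p assms(2) \<sigma>(3) hom in simp_all)
  \<comment> \<open>A first generator, not yet reduced, identifies the ramification index with \<open>p\<^sup>2\<close>.\<close>
  obtain a0 where a0: "\<sigma> a0 = a0 + 1"
    using exists_a0 by blast
  obtain a1 where "\<sigma> a1 = a1 + witt2_carry p a0 1 + 0"
    using exists_a1[OF a0] by auto
  from \<sigma>_pow_p_a1[OF a0 this K_closed(1)] have degree: "ring.dimension ring_of_type_algebra (p ^ 2) K UNIV"
    by (rule monomials_dimension[OF a0 _ K])
  obtain d where d: "ring.dimension ring_of_type_algebra d K UNIV" "\<forall>x\<in>K - {0}. vL x = int d * vK x"
    using assms(8) by (auto simp: totally_ramified_def)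
  have "d = p ^ 2"
    by (rule dimension_unique_rta[OF K d(1) degree])
  then have v_K: "vL x = int p ^ 2 * vK x" if "x \<in> K" "x \<noteq> 0" for x
    using d(2) that by simp
  have loc: "normalized_valuation K vK" "valuation_complete K vK" "normalized_valuation UNIV vL"
    using assms(3,5) by (simp_all add: local_field_def)
  interpret ramified_galois K p \<sigma> vL vK
    by (intro ramified_galois.intro ramified_cyclic_p_squared.intro discrete_valuation.intro
        ramified_cyclic_p_squared_axioms.intro ramified_galois_axioms.intro cyclic_p_squared_axioms
        K loc assms(4) v_K \<sigma>(2) degree)
  show ?thesis
    using exists_reduced_generator lower_jumps_reduced_generator unfolding Let_def by blast
qed

end
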